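(* The closed subgroups of $\operatorname{Sym}(\mathcal{V})$ containing $\operatorname{Sp}$ are exactly the following groups: (1) $\operatorname{Sp}$; (2) $\Delta$; (3) $\operatorname{GL}$; (4) $\operatorname{AGL}$; (5) $\operatorname{Sym}_0$; (6) $\operatorname{Sym}$.
   Context: Let $\mathcal{F}$ be the class of finite dimensional vector spaces over $\mathbb{F}_2$ equipped with binary relations $P_0,P_1$ such that: (1) $P_0(x,y)\leftrightarrow\neg P_1(x,y)$ for all $x,y$; (2) for all $i,j\in\mathbb{F}_2$, $P_i(x,z)\wedge P_j(y,z)\rightarrow P_{i+j}(x+y,z)$ for all $x,y,z$; (3) for all $i,j\in\mathbb{F}_2$, $P_i(x,y)\wedge P_j(x,z)\rightarrow P_{i+j}(x,y+z)$ for all $x,y,z$; (4) $P_0(x,x)$ for all $x$. (That is, finite dimensional spaces with a possibly degenerate alternating bilinear form, where $P_i(x,y)$ expresses $x\cdot y=i$.) $\mathcal{F}$ is a Fra\"iss\'e class, and $\mathcal{V}=\mathbb{F}_2^\omega(+,\cdot)$ denotes its Fra\"iss\'e limit: the (unique up to isomorphism) countable structure whose finitely generated substructures are up to isomorphism exactly the members of $\mathcal{F}$ and which is homogeneous (every isomorphism between finitely generated substructures extends to an automorphism). Its underlying vector space is $\mathbb{F}_2^\omega$, the countably infinite dimensional space over $\mathbb{F}_2$, and $x\cdot y=i$ iff $P_i(x,y)$. $\operatorname{Sp}=\operatorname{Sp}(\omega,2)$ is the automorphism group of $\mathcal{V}$, i.e. the group of vector space automorphisms preserving $\cdot$. $\operatorname{GL}=\operatorname{GL}(\omega,2)$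 is the group of all vector space automorphisms of $\mathbb{F}_2^\omega$; $\operatorname{AGL}$ is the group generated by $\operatorname{GL}$ and all translations $v\mapsto v+a$; $\operatorname{Sym}=\operatorname{Sym}(\mathcal{V})$ is the group of all permutations of the set $\mathcal{V}$ and $\operatorname{Sym}_0$ is the stabilizer of $0$ in it. The ternary relation $\triangledown$ on $\mathcal{V}$ is: $\triangledown(a,b,c)$ iff $a,b,c$ are pairwise distinct and $a\cdot b+b\cdot c+c\cdot a=1$; $\Delta=\operatorname{Aut}(\triangledown)$ is the group of all permutations $g$ of $\mathcal{V}$ such that a triple satisfies $\triangledown$ iff its image under $g$ does. A subgroup $H\le\operatorname{Sym}(\Omega)$ is closed if it is closed in the topology of pointwise convergence: whenever $\pi\in\operatorname{Sym}(\Omega)$ is such that for every finite $S\subset\Omega$ there is $\sigma_S\in H$ with $\sigma_S|_S=\pi|_S$, then $\pi\in H$. *)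

theory Defs
  imports
    "HOL-Library.Z2"
    "HOL-Library.Countable_Set"
    "HOL-Computational_Algebra.Polynomial"
    "HOL-Algebra.Bij"
    "HOL-Algebra.Generated_Groups"
begin

text \<open>
  \<open>P i x y\<close> is the relation $P_i(x,y)$, with \<open>i\<close> ranging over the two-element field \<^typ>\<open>bit\<close>.
  A space is given as a subspace \<open>S\<close> of an ambient \<^typ>\<open>bit\<close>-vector space; the values of \<open>P\<close>
  outside \<open>S\<close> are irrelevant.
\<close>

definition class_F ::
  "(bit \<Rightarrow> 'a::ab_group_add \<Rightarrow> 'a) \<Rightarrow> 'a set \<Rightarrow> (bit \<Rightarrow> 'a \<Rightarrow> 'a \<Rightarrow> bool) \<Rightarrow> bool"
where
  "class_F scale S P \<longleftrightarrow>
     vector_space scale \<and>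
     (\<exists>B. finite B \<and> \<not> module.dependent scale B \<and> module.span scale B = S) \<and>
     (\<forall>x\<in>S. \<forall>y\<in>S. P 0 x y \<longleftrightarrow> \<not> P 1 x y) \<and>
     (\<forall>i j. \<forall>x\<in>S. \<forall>y\<in>S. \<forall>z\<in>S. P i x z \<and> P j y z \<longrightarrow> P (i + j) (x + y) z) \<and>
     (\<forall>i j. \<forall>x\<in>S. \<forall>y\<in>S. \<forall>z\<in>S. P i x y \<and> P j x z \<longrightarrow> P (i + j) x (y + z)) \<and>
     (\<forall>x\<in>S. P 0 x x)"

definition struct_iso ::
  "(bit \<Rightarrow> 'a::ab_group_add \<Rightarrow> 'a) \<Rightarrow> 'a set \<Rightarrow> (bit \<Rightarrow> 'a \<Rightarrow> 'a \<Rightarrow> bool) \<Rightarrow>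
   (bit \<Rightarrow> 'b::ab_group_add \<Rightarrow> 'b) \<Rightarrow> 'b set \<Rightarrow> (bit \<Rightarrow> 'b \<Rightarrow> 'b \<Rightarrow> bool) \<Rightarrow> ('a \<Rightarrow> 'b) \<Rightarrow> bool"
where
  "struct_iso scale S P scale' T Q f \<longleftrightarrow>
     bij_betw f S T \<and>
     (\<forall>x\<in>S. \<forall>y\<in>S. f (x + y) = f x + f y) \<and>
     (\<forall>c. \<forall>x\<in>S. f (scale c x) = scale' c (f x)) \<and>
     (\<forall>i. \<forall>x\<in>S. \<forall>y\<in>S. P i x y \<longleftrightarrow> Q i (f x) (f y))"

definition Sp ::
  "(bit \<Rightarrow> 'v::ab_group_add \<Rightarrow> 'v) \<Rightarrow> (bit \<Rightarrow> 'v \<Rightarrow> 'v \<Rightarrow> bool) \<Rightarrow> ('v \<Rightarrow> 'v) set"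
where
  "Sp scale P = {g. struct_iso scale UNIV P scale UNIV P g}"

text \<open>
  The finitely generated substructures are the spans of finite sets, with the restricted relations.
  The class is closed under isomorphism, so \<open>age_sub\<close> asks for membership
  directly.  Conversely, every finite-dimensional space over \<^typ>\<open>bit\<close> is isomorphic to a subspace
  of \<^typ>\<open>bit poly\<close>, so letting the members of the class range over subspaces of that space,
  as \<open>age_sup\<close> does, reaches all of them up to isomorphism.
\<close>

locale fraisse_limit = vector_space scale
  for scale :: "bit \<Rightarrow> 'v::ab_group_add \<Rightarrow> 'v" +
  fixes P :: "bit \<Rightarrow> 'v \<Rightarrow> 'v \<Rightarrow> bool"
  assumes countable_space: "countable (UNIV :: 'v set)"
    and age_sub: "\<And>X. finite X \<Longrightarrow> class_F scale (module.span scale X) P"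
    and age_sup: "\<And>(A :: bit poly set) Q. class_F Polynomial.smult A Q \<Longrightarrow>
      \<exists>X f. finite X \<and> struct_iso Polynomial.smult A Q scale (module.span scale X) P f"
    and homogeneous: "\<And>X Y f. finite X \<Longrightarrow> finite Y \<Longrightarrow>
      struct_iso scale (module.span scale X) P scale (module.span scale Y) P f \<Longrightarrow>
      \<exists>g \<in> Sp scale P. \<forall>x \<in> module.span scale X. g x = f x"

definition dot :: "(bit \<Rightarrow> 'v \<Rightarrow> 'v \<Rightarrow> bool) \<Rightarrow> 'v \<Rightarrow> 'v \<Rightarrow> bit" where
  "dot P x y = (THE i. P i x y)"

definition Sym :: "('v \<Rightarrow> 'v) monoid" where
  "Sym = BijGroup UNIV"

definition Sym0 :: "('v::zero \<Rightarrow> 'v) set" where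
  "Sym0 = {g \<in> carrier Sym. g 0 = 0}"

definition GL :: "(bit \<Rightarrow> 'v::ab_group_add \<Rightarrow> 'v) \<Rightarrow> ('v \<Rightarrow> 'v) set" where
  "GL scale = {g \<in> carrier Sym. Vector_Spaces.linear scale scale g}"

definition AGL :: "(bit \<Rightarrow> 'v::ab_group_add \<Rightarrow> 'v) \<Rightarrow> ('v \<Rightarrow> 'v) set" where
  "AGL scale = generate Sym (GL scale \<union> range (\<lambda>a v. v + a))"

definition triangledown :: "(bit \<Rightarrow> 'v \<Rightarrow> 'v \<Rightarrow> bool) \<Rightarrow> 'v \<Rightarrow> 'v \<Rightarrow> 'v \<Rightarrow> bool" where
  "triangledown P a b c \<longleftrightarrow>
     a \<noteq> b \<and> b \<noteq> c \<and> a \<noteq> c \<and> dot P a b + dot P b c + dot P c a = 1"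

definition Delta :: "(bit \<Rightarrow> 'v \<Rightarrow> 'v \<Rightarrow> bool) \<Rightarrow> ('v \<Rightarrow> 'v) set" where
  "Delta P = {g \<in> carrier Sym.
     \<forall>a b c. triangledown P a b c \<longleftrightarrow> triangledown P (g a) (g b) (g c)}"

definition closed_in_Sym :: "('v \<Rightarrow> 'v) set \<Rightarrow> bool" where
  "closed_in_Sym H \<longleftrightarrow>
     (\<forall>\<pi> \<in> carrier Sym. (\<forall>S. finite S \<longrightarrow> (\<exists>\<sigma>\<in>H. \<forall>x\<in>S. \<sigma> x = \<pi> x)) \<longrightarrow> \<pi> \<in> H)"

lemma carrier_Sym: "carrier Sym = {f. bij f}"
  by (simp add: Sym_def BijGroup_def Bij_def)

lemma vector_space_bit_poly: "vector_space (Polynomial.smult :: bit \<Rightarrow> bit poly \<Rightarrow> bit poly)"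
  by unfold_locales (simp_all only: smult_add_right smult_add_left smult_smult smult_1_left)

context fraisse_limit
begin

lemma dot_eq_iff: "dot P x y = i \<longleftrightarrow> P i x y"
proof -
  have "class_F scale (span {x, y}) P"
    by (rule age_sub) simp
  then have *: "P 0 x y \<longleftrightarrow> \<not> P 1 x y"
    unfolding class_F_def using span_base[of x "{x, y}"] span_base[of y "{x, y}"] by blast
  have ex1: "\<exists>!i. P i x y"
  proof (cases "P 0 x y")
    case True
    then show ?thesis using * by (metis bit.exhaust)
  next
    case False
    then show ?thesis using * by (metis bit.exhaust)
  qed
  show ?thesis
    unfolding dot_def using theI'[OF ex1] ex1 by blast
qed

lemma Sp_eq: "Sp scale P = {g \<in> GL scale. \<forall>x y. dot P (g x) (g y) = dot P x y}"
proof -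
  have "vector_space scale" by unfold_locales
  then have lin: "Vector_Spaces.linear scale scale g \<longleftrightarrow>
      (\<forall>x y. g (x + y) = g x + g y) \<and> (\<forall>c x. g (scale c x) = scale c (g x))" for g
    by (simp add: Vector_Spaces.linear_iff)
  have form: "(\<forall>x y. dot P (g x) (g y) = dot P x y) \<longleftrightarrow>
      (\<forall>i x y. P i x y \<longleftrightarrow> P i (g x) (g y))" for g
    using dot_eq_iff by metis
  show ?thesis
    unfolding Sp_def struct_iso_def GL_def carrier_Sym form lin by auto
qed

end

end

theory Submission
  imports Defs
begin

text \<open>
  Let \<open>G\<close> be a closed group containing \<open>Sp\<close>. If \<open>G\<close> is linear but not \<open>Sp\<close>, then conjugating
  a transvection gives a map \<open>x + \<phi>(x) q\<close> in \<open>G\<close> with \<open>\<phi>\<close> different from the product with \<open>q\<close>.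
  Such maps change a single product in a finite independent set, so \<open>G\<close> moves every such set to an
  isotropic one, whence \<open>G = GL\<close>.

  Suppose next that \<open>G\<close> fixes 0 and is not linear. Every finite set of nonzero vectors has an
  independent image under \<open>G\<close>: a minimal counterexample has the form \<open>A \<union> {\<Sum>A}\<close> with \<open>A\<close> independent,
  for all \<open>A\<close> of a given Gram matrix, and each size of \<open>A\<close> leads to a contradiction.
  If some finite pointwise stabilizer were intransitive on the remaining nonzero vectors, then the
  pointwise stabilizer of an independent set of size \<open>m k\<close> (with \<open>k\<close> fixed) would have at least
  \<open>2^m\<close> orbits. But the nonzero vectors of an \<open>r\<close>-dimensional subspace, of which there are
  \<open>2^r - 1\<close>, have an independent image, while their stabilizer has at most \<open>2^(r+1)\<close> orbits. So \<open>G\<close> is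
  highly transitive on nonzero vectors and contains \<open>Sym0\<close>.

  Finally, if \<open>G\<close> moves 0, it is transitive, and the stabilizer of 0 is \<open>Sp\<close>, \<open>GL\<close> or \<open>Sym0\<close>.
  The last case gives \<open>Sym\<close>. In the other two, the affine structure is definable from fixed points of
  stabilizers, and \<open>G\<close> is \<open>Delta\<close>, consisting of the symplectic maps composed with translations, or \<open>AGL\<close>.
\<close>

text \<open>Rewriting sums of bits to XOR would block the laws of addition.\<close>
declare add_bit_eq_xor [simp del]

lemma bit_add_self [simp]: "(a::bit) + a = 0"
  by (cases a) simp_all

lemma bit_add_self_left [simp]: "(a::bit) + (a + b) = b"
  by (simp flip: add.assoc)

lemma bit_add_eq_0_iff [simp]: "(a::bit) + b = 0 \<longleftrightarrow> a = b"
  by (cases a; cases b) simp_all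

subsection \<open>Linear algebra over the two-element field\<close>

context fraisse_limit
begin

abbreviation form (infixl "\<cdot>" 70) where "x \<cdot> y \<equiv> dot P x y"

lemma scale_bit: "scale c x = (if c = 1 then x else 0)"
  by (cases c) simp_all

lemma add_self [simp]: "x + x = (0::'v)"
  using scale_left_distrib[of 1 1 x] by simp

lemma add_self_left [simp]: "x + (x + y) = (y::'v)"
  by (simp flip: add.assoc)

lemma uminus_eq [simp]: "- x = (x::'v)"
  by (rule minus_unique) simp

lemma diff_eq_add [simp]: "x - y = x + (y::'v)"
  by (simp only: diff_conv_add_uminus uminus_eq)

lemma add_eq_0_iff_eq: "x + y = 0 \<longleftrightarrow> x = (y::'v)"
  by (metis add_self add_self_left add_0_right)

lemma add_eq_iff_eq_add: "x + y = z \<longleftrightarrow> x = y + (z::'v)"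
  by (metis add_self_left add.commute)

text \<open>The only scalars are 0 and 1, so additivity already gives compatibility with scalars.
  Linear maps are handled as additive ones from here on.\<close>

lemma linear_iff_additive:
  "Vector_Spaces.linear scale scale g \<longleftrightarrow> (\<forall>x y. g (x + y) = g x + g y)"
proof
  assume "\<forall>x y. g (x + y) = g x + g y"
  then have add: "g (x + y) = g x + g y" for x y by blast
  moreover have "g 0 = 0" using add[of 0 0] by simp
  ultimately show "Vector_Spaces.linear scale scale g"
    by unfold_locales (auto simp: scale_bit)
qed (simp add: Vector_Spaces.linear_iff)

lemma subspace_iff: "subspace S \<longleftrightarrow> 0 \<in> S \<and> (\<forall>x\<in>S. \<forall>y\<in>S. x + y \<in> S)"
  unfolding subspace_def by (auto simp: scale_bit)

lemma span_bit_induct [consumes 1, case_names zero base add]: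
  assumes "x \<in> span A" "Q 0" "\<And>a. a \<in> A \<Longrightarrow> Q a"
    "\<And>x y. x \<in> span A \<Longrightarrow> y \<in> span A \<Longrightarrow> Q x \<Longrightarrow> Q y \<Longrightarrow> Q (x + y)"
  shows "Q x"
proof -
  have "subspace {x \<in> span A. Q x}"
    using assms(2,4) by (auto simp: subspace_iff span_zero span_add)
  then have "span A \<subseteq> {x \<in> span A. Q x}"
    using assms(3) by (intro span_minimal) (auto simp: span_base)
  then show ?thesis using assms(1) by blast
qed

lemma span_insert_bit: "span (insert a A) = span A \<union> (+) a ` span A"
proof (intro equalityI subsetI)
  fix x assume "x \<in> span (insert a A)"
  then obtain k where "x - scale k a \<in> span A" unfolding span_insert by blast
  then show "x \<in> span A \<union> (+) a ` span A"
    by (cases k) (auto simp: image_iff add.commute intro!: bexI[of _ "x + a"])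
next
  fix x assume "x \<in> span A \<union> (+) a ` span A"
  then show "x \<in> span (insert a A)"
    using span_mono[OF subset_insertI[of A a]]
    by (auto intro!: span_add[OF span_base])
qed

lemma finite_span: "finite A \<Longrightarrow> finite (span A)"
  by (induction A rule: finite_induct) (auto simp: span_insert_bit)

lemma card_span_independent:
  assumes "finite A" "independent A"
  shows "card (span A) = 2 ^ card A"
  using assms
proof (induction A rule: finite_induct)
  case (insert a A)
  then have "a \<notin> span A" "independent A"
    using independent_insert[of a A] by auto
  have "a + x \<notin> span A" if "x \<in> span A" for x
    using \<open>a \<notin> span A\<close> span_add[OF _ that, of "a + x"] that by (auto simp: add.assoc)
  then have "span A \<inter> (+) a ` span A = {}" by blast
  then have "card (span (insert a A)) = card (span A) + card ((+) a ` span A)"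
    unfolding span_insert_bit using insert.hyps(1) by (intro card_Un_disjoint) (auto simp: finite_span)
  then show ?case using insert \<open>independent A\<close> by (simp add: card_image)
qed simp

lemma finite_basis:
  assumes "finite A"
  obtains B where "B \<subseteq> A" "finite B" "independent B" "span B = span A"
  by (metis assms finite_subset maximal_independent_subset span_minimal span_mono
      subset_antisym subspace_span)

lemma span_image_additive_on:
  assumes add: "\<And>x y. x \<in> span A \<Longrightarrow> y \<in> span A \<Longrightarrow> h (x + y) = h x + h y"
  shows "h ` span A = span (h ` A)"
proof
  have h0: "h 0 = 0" using add[of 0 0] by (simp add: span_zero)
  have "h x \<in> span (h ` A)" if "x \<in> span A" for x
    using that by (induction rule: span_bit_induct) (auto simp: h0 add span_zero span_base span_add)
  then show "h ` span A \<subseteq> span (h ` A)" by blast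
  have "subspace (h ` span A)"
    unfolding subspace_iff
  proof (intro conjI ballI)
    show "0 \<in> h ` span A" using h0 span_zero by force
    fix x y assume "x \<in> h ` span A" "y \<in> h ` span A"
    then show "x + y \<in> h ` span A" using add span_add by (auto simp flip: add)
  qed
  then show "span (h ` A) \<subseteq> h ` span A"
    by (intro span_minimal) (auto simp: span_base)
qed

section \<open>Bilinearity of the form\<close>

lemma dot_add_left: "(x + y) \<cdot> z = x \<cdot> z + y \<cdot> z"
  and dot_add_right: "x \<cdot> (y + z) = x \<cdot> y + x \<cdot> z"
  and dot_self [simp]: "x \<cdot> x = 0"
proof -
  have F: "class_F scale (span {x, y, z}) P" by (rule age_sub) simp
  have in_span: "x \<in> span {x, y, z}" "y \<in> span {x, y, z}" "z \<in> span {x, y, z}"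
    by (simp_all add: span_base)
  show "(x + y) \<cdot> z = x \<cdot> z + y \<cdot> z"
    using F in_span dot_eq_iff unfolding class_F_def by metis
  show "x \<cdot> (y + z) = x \<cdot> y + x \<cdot> z"
    using F in_span dot_eq_iff unfolding class_F_def by metis
  show "x \<cdot> x = 0"
    using F in_span dot_eq_iff unfolding class_F_def by metis
qed

lemma dot_zero_left [simp]: "0 \<cdot> x = 0"
  using dot_add_left[of x x x] dot_self[of x] by (simp del: dot_self)

lemma dot_zero_right [simp]: "x \<cdot> 0 = 0"
  using dot_add_right[of x x x] by simp

lemma dot_commute: "x \<cdot> y = y \<cdot> x"
  using dot_self[of "x + y"] by (simp add: dot_add_left dot_add_right del: dot_self) (simp)

lemma Sp_iff:
  "g \<in> Sp scale P \<longleftrightarrow> bij g \<and> (\<forall>x y. g (x + y) = g x + g y) \<and> (\<forall>x y. g x \<cdot> g y = x \<cdot> y)"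
  by (auto simp: Sp_eq GL_def carrier_Sym linear_iff_additive)

section \<open>Additive maps and the extension of partial isometries\<close>

lemma additive_zero:
  fixes h :: "'a::ab_group_add \<Rightarrow> 'b::ab_group_add"
  assumes "\<And>x y. h (x + y) = h x + h y"
  shows "h 0 = 0"
  using assms[of 0 0] by simp

lemma additive_eq_on_span:
  assumes "\<And>x y. h (x + y) = h x + h y" "\<And>x y. k (x + y) = k x + (k y :: 'b::ab_group_add)"
    "\<And>a. a \<in> A \<Longrightarrow> h a = k a" "x \<in> span A"
  shows "h x = k x"
  using assms(4) by (induction rule: span_bit_induct) (simp_all add: assms additive_zero)

lemma additive_sum:
  fixes h :: "'a::ab_group_add \<Rightarrow> 'b::ab_group_add"
  assumes "\<And>x y. h (x + y) = h x + h y"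
  shows "h (sum f A) = (\<Sum>a\<in>A. h (f a))"
  by (induction A rule: infinite_finite_induct) (simp_all add: assms additive_zero[of h, OF assms])

lemma dot_sum_left: "sum f A \<cdot> y = (\<Sum>a\<in>A. f a \<cdot> y)"
  by (rule additive_sum) (simp add: dot_add_left)

text \<open>Homogeneity in usable form: by additivity the image of \<open>span A\<close> is the span
  of the image of \<open>A\<close>, so \<open>h\<close> is an isomorphism of finitely generated
  substructures.\<close>

lemma Sp_extend_subspace:
  assumes "finite A"
    and add: "\<And>x y. x \<in> span A \<Longrightarrow> y \<in> span A \<Longrightarrow> h (x + y) = h x + h y"
    and inj: "inj_on h (span A)"
    and dot: "\<And>x y. x \<in> span A \<Longrightarrow> y \<in> span A \<Longrightarrow> h x \<cdot> h y = x \<cdot> y"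
  shows "\<exists>s\<in>Sp scale P. \<forall>x\<in>span A. s x = h x"
proof -
  have im: "h ` span A = span (h ` A)" using add by (rule span_image_additive_on)
  have h0: "h 0 = 0" using add[of 0 0] by (simp add: span_zero)
  have "struct_iso scale (span A) P scale (span (h ` A)) P h"
    unfolding struct_iso_def
    using inj im add dot h0 by (auto simp: bij_betw_def scale_bit dot_eq_iff[symmetric])
  then show ?thesis using homogeneous[of A "h ` A" h] assms(1) by blast
qed

interpretation pair: vector_space_pair scale scale ..

text \<open>The linear extension of \<open>f\<close> is injective on \<open>span A\<close> because
  \<open>f\<close> keeps independence, and bilinearity carries the preserved products from
  \<open>A\<close> to its span.\<close>

lemma Sp_extend_independent:
  assumes A: "finite A" "independent A" and fA: "inj_on f A" "independent (f ` A)"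
    and dot: "\<And>a b. a \<in> A \<Longrightarrow> b \<in> A \<Longrightarrow> f a \<cdot> f b = a \<cdot> b"
  shows "\<exists>s\<in>Sp scale P. \<forall>a\<in>A. s a = f a"
proof -
  obtain h where h: "Vector_Spaces.linear scale scale h" "\<And>a. a \<in> A \<Longrightarrow> h a = f a"
    using pair.linear_independent_extend[OF A(2), of f] by blast
  then have add: "h (x + y) = h x + h y" for x y by (simp add: linear_iff_additive)
  have im: "h ` A = f ` A" using h(2) by force
  have "inj_on h A" using fA(1) h(2) by (simp add: inj_on_def)
  then have "inj_on h (span A)"
    using pair.linear_inj_on_span_independent_image[OF h(1)] fA(2) im by simp
  moreover have "h x \<cdot> h y = x \<cdot> y" if "x \<in> span A" "y \<in> span A" for x y
    using that(1)
  proof (induction rule: span_bit_induct)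
    case (base a)
    show ?case using that(2)
      by (induction rule: span_bit_induct)
         (simp_all add: base h(2) dot add dot_add_right additive_zero[of h, OF add])
  qed (simp_all add: add dot_add_left additive_zero[of h, OF add])
  ultimately show ?thesis
    using Sp_extend_subspace[OF A(1), of h] add h(2) by (metis span_base)
qed

text \<open>Fixing a basis of \<open>span A\<close> and sending \<open>x\<close> to \<open>y\<close>
  maps one independent set to another with the same products. Thus products with \<open>A\<close>
  classify the points outside \<open>span A\<close> under the stabilizer.\<close>

lemma Sp_transport:
  assumes "finite A" "x \<notin> span A" "y \<notin> span A" "\<And>a. a \<in> A \<Longrightarrow> x \<cdot> a = y \<cdot> a"
  shows "\<exists>s\<in>Sp scale P. (\<forall>a\<in>span A. s a = a) \<and> s x = y"
proof -
  obtain B where B: "B \<subseteq> A" "finite B" "independent B" "span B = span A"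
    using finite_basis assms(1) by metis
  define f where "f = (\<lambda>a. if a = x then y else a)"
  have x: "x \<notin> B" "y \<notin> B" using assms(2,3) span_base B(4) by blast+
  then have f: "f a = a" if "a \<in> B" for a using that by (auto simp: f_def)
  have fx: "f x = y" by (simp add: f_def)
  have im: "f ` insert x B = insert y B" using f fx by auto
  have y_dot: "y \<cdot> a = x \<cdot> a" "a \<cdot> y = a \<cdot> x" if "a \<in> B" for a
    using assms(4)[of a] B(1) that dot_commute[of a] by auto
  have "\<exists>s\<in>Sp scale P. \<forall>a\<in>insert x B. s a = f a"
  proof (rule Sp_extend_independent)
    show "inj_on f (insert x B)" using x f fx by (auto simp: inj_on_def)
    show "independent (insert x B)" "independent (f ` insert x B)"
      unfolding im using B assms by (simp_all add: independent_insertI)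
    fix a b assume "a \<in> insert x B" "b \<in> insert x B"
    then show "f a \<cdot> f b = a \<cdot> b" by (auto simp: f fx y_dot)
  qed (use B in auto)
  then obtain s where s: "s \<in> Sp scale P" "\<And>a. a \<in> insert x B \<Longrightarrow> s a = f a" by blast
  have "s a = a" if "a \<in> span A" for a
    using that unfolding B(4)[symmetric]
    by (rule additive_eq_on_span[rotated -1]) (use s f in \<open>auto simp: Sp_iff\<close>)
  then show ?thesis using s fx by auto
qed

section \<open>Points with prescribed products\<close>

lemma additive_extend_independent:
  fixes scale' :: "bit \<Rightarrow> 'b::ab_group_add \<Rightarrow> 'b" and f :: "'v \<Rightarrow> 'b"
  assumes "vector_space scale'" and "independent A"
  obtains h
  where "\<And>x y. h (x + y) = h x + h y" "\<And>a. a \<in> A \<Longrightarrow> h a = f a"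
proof -
  interpret W: vector_space scale' by fact
  interpret vector_space_pair scale scale' ..
  obtain h where "Vector_Spaces.linear scale scale' h" "\<And>a. a \<in> A \<Longrightarrow> h a = f a"
    using linear_independent_extend[OF assms(2), of f] by blast
  then show ?thesis by (intro that[of h]) (auto simp: Vector_Spaces.linear_iff)
qed

lemma functional_extend_independent:
  fixes c :: "'v \<Rightarrow> bit"
  assumes "independent A"
  obtains l
  where "\<And>x y. l (x + y) = l x + l y" "\<And>a. a \<in> A \<Longrightarrow> l a = c a"
proof -
  have "vector_space ((*) :: bit \<Rightarrow> bit \<Rightarrow> bit)"
    by unfold_locales (simp_all add: distrib_left distrib_right mult.assoc del: mult_bit_eq_and)
  from additive_extend_independent[OF this assms, of c] show ?thesis
    using that by blast
qed

text \<open>\<open>age_sup\<close> speaks only of subspaces of \<open>bit poly\<close>, so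
  \<open>span A\<close> is transferred there: \<open>\<psi>\<close> sends the basis to monomials of
  degree below \<open>n\<close>, \<open>\<phi>\<close> leads back, and \<open>monom 1 n\<close>,
  killed by \<open>\<phi>\<close>, is room for one new basis vector.\<close>

lemma coordinates:
  assumes "finite A" "independent A"
  obtains n :: nat and \<phi> :: "bit poly \<Rightarrow> 'v" and \<psi> :: "'v \<Rightarrow> bit poly"
  where "\<And>p q. \<phi> (p + q) = \<phi> p + \<phi> q" "\<And>x y. \<psi> (x + y) = \<psi> x + \<psi> y"
    "\<phi> (monom 1 n) = 0"
    "\<And>x. x \<in> span A \<Longrightarrow> \<phi> (\<psi> x) = x \<and> coeff (\<psi> x) n = 0"
    "\<And>x. x \<in> span A \<Longrightarrow> \<psi> x \<in> module.span Polynomial.smult (monom 1 ` {..n})"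
proof -
  obtain e :: "'v \<Rightarrow> nat" and n where e: "e ` A = {i. i < n}" "inj_on e A"
    using finite_imp_inj_to_nat_seg[OF assms(1)] by metis
  define \<phi> where "\<phi> p = (\<Sum>a\<in>A. scale (coeff p (e a)) a)" for p :: "bit poly"
  interpret bp: vector_space "Polynomial.smult :: bit \<Rightarrow> bit poly \<Rightarrow> bit poly"
    by (rule vector_space_bit_poly)
  obtain \<psi> :: "'v \<Rightarrow> bit poly" where \<psi>: "\<And>x y. \<psi> (x + y) = \<psi> x + \<psi> y"
    "\<And>a. a \<in> A \<Longrightarrow> \<psi> a = monom 1 (e a)"
    using additive_extend_independent[OF vector_space_bit_poly assms(2), of "\<lambda>a. monom 1 (e a)"]
    by metis
  have \<psi>0: "\<psi> 0 = 0" by (rule additive_zero) (rule \<psi>(1))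
  have \<phi>: "\<phi> (p + q) = \<phi> p + \<phi> q" for p q
    by (simp add: \<phi>_def scale_left_distrib sum.distrib)
  have lt: "e a < n" if "a \<in> A" for a using e(1) that by auto
  then have n: "e a \<noteq> n" if "a \<in> A" for a using that by fastforce
  have \<phi>_monom: "\<phi> (monom 1 (e a)) = a" if "a \<in> A" for a
  proof -
    have "\<phi> (monom 1 (e a)) = (\<Sum>b\<in>A. if b = a then b else 0)"
      unfolding \<phi>_def using e(2) that by (intro sum.cong) (auto simp: inj_on_def)
    then show ?thesis using that assms(1) by (simp add: sum.delta)
  qed
  show ?thesis
  proof
    show "\<phi> (p + q) = \<phi> p + \<phi> q" for p q by (rule \<phi>)
    show "\<psi> (x + y) = \<psi> x + \<psi> y" for x y by (rule \<psi>)
    show "\<phi> (monom 1 n) = 0" unfolding \<phi>_def using n by (intro sum.neutral) auto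
    show "\<phi> (\<psi> x) = x \<and> coeff (\<psi> x) n = 0" if "x \<in> span A" for x
      using that
      by (induction rule: span_bit_induct)
         (auto simp: \<psi> \<psi>0 \<phi> \<phi>_monom additive_zero[of \<phi>, OF \<phi>] dest: n)
    show "\<psi> x \<in> module.span Polynomial.smult (monom 1 ` {..n})" if "x \<in> span A" for x
      using that
      by (induction rule: span_bit_induct)
         (use lt in \<open>auto simp: \<psi> \<psi>0 bp.span_zero bp.span_add less_imp_le intro!: bp.span_base imageI\<close>)
  qed
qed

text \<open>Extension property of the limit: the one-point extension of \<open>span A\<close> with
  the prescribed products lies in the class and embeds by \<open>age_sup\<close>. Homogeneity
  carries \<open>span A\<close> onto its copy, and pulling back the new vector gives
  \<open>x\<close>.\<close>

lemma exists_point_independent: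
  assumes A: "finite A" "independent A"
  shows "\<exists>x. x \<notin> span A \<and> (\<forall>a\<in>A. x \<cdot> a = c a)"
proof -
  obtain n and \<phi> :: "bit poly \<Rightarrow> 'v" and \<psi> :: "'v \<Rightarrow> bit poly" where \<phi>: "\<And>p q. \<phi> (p + q) = \<phi> p + \<phi> q"
    and \<psi>: "\<And>x y. \<psi> (x + y) = \<psi> x + \<psi> y"
    and \<phi>n: "\<phi> (monom 1 n) = 0"
    and \<phi>\<psi>: "\<And>x. x \<in> span A \<Longrightarrow> \<phi> (\<psi> x) = x \<and> coeff (\<psi> x) n = 0"
    and \<psi>S: "\<And>x. x \<in> span A \<Longrightarrow> \<psi> x \<in> module.span Polynomial.smult (monom 1 ` {..n})"
    by (rule coordinates[OF A]) blast
  interpret bp: vector_space "Polynomial.smult :: bit \<Rightarrow> bit poly \<Rightarrow> bit poly"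
    by (rule vector_space_bit_poly)
  define S where "S = bp.span (monom 1 ` {..n})"
  obtain l :: "'v \<Rightarrow> bit" where l: "\<And>x y. l (x + y) = l x + l y" "\<And>a. a \<in> A \<Longrightarrow> l a = c a"
    by (rule functional_extend_independent[OF A(2), of c]) blast
  text \<open>The form of \<open>span A\<close> extended to one more basis vector, whose products are given by \<open>l\<close>.\<close>
  define q where "q x y = \<phi> x \<cdot> \<phi> y + coeff x n * l (\<phi> y) + coeff y n * l (\<phi> x)" for x y
  have q_add: "q (x + y) z = q x z + q y z" "q x (y + z) = q x y + q x z" for x y z
    by (simp_all add: q_def \<phi> l(1) dot_add_left dot_add_right distrib_left distrib_right ac_simps
        del: mult_bit_eq_and)
  have q_self: "q x x = 0" for x by (simp add: q_def del: mult_bit_eq_and)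
  obtain B where B: "B \<subseteq> monom 1 ` {..n}" "bp.independent B" "monom 1 ` {..n} \<subseteq> bp.span B"
    using bp.maximal_independent_subset by metis
  then have "bp.span B = S"
    unfolding S_def by (intro subset_antisym bp.span_mono bp.span_minimal bp.subspace_span)
  moreover have "finite B" using B(1) by (rule finite_subset) simp
  ultimately have "class_F Polynomial.smult S (\<lambda>i x y. q x y = i)"
    unfolding class_F_def using vector_space_bit_poly B(2) by (auto simp: q_add q_self)
  from age_sup[OF this] obtain X f where "finite X"
    and f: "struct_iso Polynomial.smult S (\<lambda>i x y. q x y = i) scale (span X) P f"
    by blast
  have f_bij: "bij_betw f S (span X)"
    and f_add: "f (x + y) = f x + f y" and f_P: "q x y = i \<longleftrightarrow> P i (f x) (f y)"
    if "x \<in> S" "y \<in> S" for x y i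
    using f that by (simp_all add: struct_iso_def)
  have f_dot: "f x \<cdot> f y = q x y" and f_inj: "f x = f y \<longleftrightarrow> x = y" if "x \<in> S" "y \<in> S" for x y
    using f_bij f_P[of x y "q x y"] that unfolding dot_eq_iff by (auto simp: bij_betw_def inj_on_def)
  have n: "monom 1 n \<in> S" unfolding S_def by (intro bp.span_base) auto
  note \<psi>S = \<psi>S[folded S_def]
  have "\<exists>s\<in>Sp scale P. \<forall>x\<in>span A. s x = f (\<psi> x)"
  proof (rule Sp_extend_subspace)
    show "inj_on (\<lambda>x. f (\<psi> x)) (span A)"
      using f_inj \<psi>S \<phi>\<psi> unfolding inj_on_def by metis
  qed (use A(1) f_add \<psi>S \<psi> f_dot q_def \<phi>\<psi> in simp_all)
  then obtain s where s: "s \<in> Sp scale P" "\<And>x. x \<in> span A \<Longrightarrow> s x = f (\<psi> x)" by blast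
  then obtain x where x: "s x = f (monom 1 n)" unfolding Sp_iff by (metis bij_pointE)
  have "x \<notin> span A"
  proof
    assume "x \<in> span A"
    then have "monom 1 n = \<psi> x" using f_inj[OF n] \<psi>S s(2) x by metis
    then show False using \<phi>\<psi>[OF \<open>x \<in> span A\<close>] by (metis coeff_monom zero_neq_one)
  qed
  moreover have "x \<cdot> a = c a" if "a \<in> A" for a
  proof -
    have a: "a \<in> span A" by (rule span_base) fact
    have "x \<cdot> a = s x \<cdot> s a" using s(1) by (simp add: Sp_iff)
    also have "\<dots> = q (monom 1 n) (\<psi> a)" using f_dot[OF n \<psi>S[OF a]] s(2)[OF a] x by simp
    also have "\<dots> = c a" using \<phi>\<psi>[OF a] l that by (simp add: q_def \<phi>n additive_zero[of l])
    finally show ?thesis .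
  qed
  ultimately show ?thesis by blast
qed

lemma exists_point:
  assumes "finite F" and A: "finite A" "independent A"
  obtains x where "x \<notin> span (A \<union> F)" "\<And>a. a \<in> A \<Longrightarrow> x \<cdot> a = c a"
proof -
  obtain B where B: "A \<subseteq> B" "B \<subseteq> A \<union> F" "independent B" "A \<union> F \<subseteq> span B"
    using maximal_independent_subset_extend[of A "A \<union> F"] A by blast
  then have "finite B" using assms by (meson finite_UnI finite_subset)
  then obtain x where "x \<notin> span B" "\<And>a. a \<in> B \<Longrightarrow> x \<cdot> a = c a"
    using exists_point_independent[of B c] B by blast
  then show ?thesis using that B(1,4) span_minimal[of "A \<union> F" "span B"] by blast
qed

text \<open>Serves to replace \<open>x\<close> by a point with the same products that avoids
  finitely many bad positions, and to show that points off a span are not fixed.\<close>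

lemma exists_point_like:
  assumes "finite F" "finite A"
  obtains y where "y \<notin> span (insert x (A \<union> F))" "\<And>a. a \<in> span A \<Longrightarrow> y \<cdot> a = x \<cdot> a"
proof -
  obtain B where B: "B \<subseteq> A" "finite B" "independent B" "span B = span A"
    using finite_basis[OF assms(2)] by metis
  obtain y where y: "y \<notin> span (B \<union> insert x (A \<union> F))" "\<And>a. a \<in> B \<Longrightarrow> y \<cdot> a = x \<cdot> a"
    using exists_point[of "insert x (A \<union> F)" B "\<lambda>a. x \<cdot> a"] assms B by auto
  have "y \<cdot> a = x \<cdot> a" if "a \<in> span A" for a
    using that unfolding B(4)[symmetric]
    by (rule additive_eq_on_span[rotated -1]) (auto simp: dot_add_right y)
  moreover have "B \<union> insert x (A \<union> F) = insert x (A \<union> F)" using B(1) by blast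
  ultimately show ?thesis using that y(1) by metis
qed

lemma nondegenerate: "(\<And>y. x \<cdot> y = 0) \<Longrightarrow> x = 0"
proof (rule ccontr)
  assume 0: "\<And>y. x \<cdot> y = 0" and "x \<noteq> 0"
  then have "independent {x}" by (simp add: independent_insertI)
  then obtain y where "y \<cdot> x = 1" using exists_point[of "{}" "{x}" "\<lambda>_. 1"] by auto
  then show False using 0[of y] by (simp add: dot_commute)
qed

text \<open>For a system \<open>y\<close> dual to \<open>A\<close>, every \<open>x\<close> differs
  from a combination of the \<open>y a\<close> by a vector orthogonal to \<open>A\<close>. So
  \<open>\<phi>\<close> is determined by the values \<open>\<phi> (y a)\<close>, and
  \<open>r\<close> is built to reproduce them.\<close>

lemma functional_eq_dot:
  assumes A: "finite A" "independent A"
    and add: "\<And>x y. \<phi> (x + y) = \<phi> x + (\<phi> y :: bit)"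
    and van: "\<And>x. (\<And>a. a \<in> A \<Longrightarrow> x \<cdot> a = 0) \<Longrightarrow> \<phi> x = 0"
  obtains r where "r \<in> span A" "\<And>x. \<phi> x = x \<cdot> r"
proof -
  have "\<exists>y. \<forall>b\<in>A. y \<cdot> b = (if b = a then 1 else 0)" for a
    using exists_point[of "{}" A "\<lambda>b. if b = a then 1 else 0"] A by (metis finite.emptyI)
  then obtain y where y: "\<And>a b. b \<in> A \<Longrightarrow> y a \<cdot> b = (if b = a then 1 else 0)" by metis
  define r where "r = (\<Sum>a\<in>A. scale (\<phi> (y a)) a)"
  have "r \<in> span A" unfolding r_def by (intro span_sum span_scale span_base)
  moreover have "\<phi> x = x \<cdot> r" for x
  proof -
    define z where "z = (\<Sum>a\<in>A. scale (x \<cdot> a) (y a))"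
    have "z \<cdot> b = x \<cdot> b" if "b \<in> A" for b
    proof -
      have "z \<cdot> b = (\<Sum>a\<in>A. scale (x \<cdot> a) (y a) \<cdot> b)"
        unfolding z_def by (rule dot_sum_left)
      also have "\<dots> = (\<Sum>a\<in>A. if a = b then x \<cdot> a else 0)"
        using that by (intro sum.cong) (auto simp: scale_bit y)
      finally show ?thesis using that A(1) by simp
    qed
    then have "\<phi> (x + z) = 0" by (intro van) (simp add: dot_add_left)
    then have "\<phi> x = \<phi> z" by (simp add: add)
    also have "\<dots> = (\<Sum>a\<in>A. \<phi> (scale (x \<cdot> a) (y a)))"
      unfolding z_def by (rule additive_sum) (rule add)
    also have "\<dots> = (\<Sum>a\<in>A. x \<cdot> scale (\<phi> (y a)) a)"
      using additive_zero[of \<phi>] add by (intro sum.cong) (auto simp: scale_bit)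
    also have "\<dots> = x \<cdot> r"
      unfolding r_def by (rule additive_sum[symmetric]) (rule dot_add_right)
    finally show ?thesis .
  qed
  ultimately show ?thesis using that by blast
qed

section \<open>Transvections and functionals\<close>

text \<open>The symbol \<open>inv\<close> is taken by the inverse in a group.\<close>
abbreviation finv :: "('v \<Rightarrow> 'v) \<Rightarrow> 'v \<Rightarrow> 'v" where "finv \<equiv> inv_into UNIV"

lemma independent_image_additive:
  assumes "\<And>x y. h (x + y) = h x + h y" "inj h" "independent A"
  shows "independent (h ` A)"
proof -
  have "Vector_Spaces.linear scale scale h" using assms(1) by (simp add: linear_iff_additive)
  then show ?thesis
    using pair.linear_independent_injective_image[of h A] assms(2,3) inj_on_subset by blast
qed

lemma independent_pair:
  assumes "x \<noteq> 0" "y \<noteq> 0" "x \<noteq> y"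
  shows "independent {x, y}"
  using assms by (simp add: independent_insert span_insert_bit)

text \<open>Additivity comes for free: by surjectivity the defect
  \<open>g (x + y) + (g x + g y)\<close> is orthogonal to everything, and the form is
  nondegenerate.\<close>

lemma dot_preserving_in_Sp:
  assumes "bij g" and dot: "\<And>x y. g x \<cdot> g y = x \<cdot> y"
  shows "g \<in> Sp scale P"
proof -
  have "g (x + y) = g x + g y" for x y
  proof -
    have "g (x + y) + (g x + g y) = 0"
    proof (rule nondegenerate)
      fix z
      obtain z' where "z = g z'" using assms(1) by (metis bij_pointE)
      then show "(g (x + y) + (g x + g y)) \<cdot> z = 0"
        by (simp add: dot_add_left dot)
    qed
    then show ?thesis by (simp add: add_eq_0_iff_eq)
  qed
  then show ?thesis using assms by (simp add: Sp_iff)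
qed

lemma transvection_in_Sp: "(\<lambda>x. x + scale (x \<cdot> p) p) \<in> Sp scale P"
proof -
  define t where "t x = x + scale (x \<cdot> p) p" for x
  have "t (t x) = x" for x by (simp add: t_def dot_add_left scale_bit add.assoc)
  then have "bij t" by (rule involuntory_imp_bij)
  moreover have "t (x + y) = t x + t y" for x y
    by (simp add: t_def dot_add_left scale_left_distrib ac_simps)
  moreover have "t x \<cdot> t y = x \<cdot> y" for x y
    by (simp add: t_def dot_add_left dot_add_right scale_bit dot_commute[of p])
  ultimately show ?thesis by (simp add: Sp_iff t_def[abs_def])
qed

text \<open>If \<open>\<phi>\<close> is the product with some \<open>r\<close>, its value is one
  more product to prescribe, and \<open>R = {q, r}\<close>. Otherwise \<open>\<phi>\<close> is
  nonzero somewhere on the orthogonal complement of any finite set, so it can be adjusted without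
  changing products, and \<open>R = {q}\<close>.\<close>

lemma exists_point_functional:
  assumes add: "\<And>x y. \<phi> (x + y) = \<phi> x + (\<phi> y :: bit)"
    and \<phi>1: "\<phi> u = 1" and q: "q \<noteq> 0" and \<phi>q: "\<phi> v \<noteq> v \<cdot> q"
  obtains R where "finite R" "independent R" "q \<in> R"
    "\<And>A c b e. finite A \<Longrightarrow> independent A \<Longrightarrow> R \<subseteq> A \<Longrightarrow>
       \<exists>x. x \<notin> span A \<and> (\<forall>a\<in>A - R. x \<cdot> a = c a) \<and> x \<cdot> q = b \<and> \<phi> x = e"
proof (cases "\<exists>r. \<forall>x. \<phi> x = x \<cdot> r")
  case True
  then obtain r where r: "\<And>x. \<phi> x = x \<cdot> r" by blast
  have "r \<noteq> 0" using \<phi>1 r by auto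
  moreover have "r \<noteq> q" using \<phi>q r by auto
  ultimately have "independent {q, r}" using q by (intro independent_pair) auto
  moreover have "\<exists>x. x \<notin> span A \<and> (\<forall>a\<in>A - {q, r}. x \<cdot> a = c a) \<and> x \<cdot> q = b \<and> \<phi> x = e"
    if A: "finite A" "independent A" "{q, r} \<subseteq> A" for A c b e
  proof -
    obtain x where "x \<notin> span A" "\<forall>a\<in>A. x \<cdot> a = (if a = q then b else if a = r then e else c a)"
      using exists_point_independent[OF A(1,2), of "\<lambda>a. if a = q then b else if a = r then e else c a"]
      by blast
    then show ?thesis using A(3) \<open>r \<noteq> q\<close> unfolding r by (intro exI[of _ x]) auto
  qed
  ultimately show ?thesis using that[of "{q, r}"] by blast
next
  case False
  have "\<exists>x. x \<notin> span A \<and> (\<forall>a\<in>A - {q}. x \<cdot> a = c a) \<and> x \<cdot> q = b \<and> \<phi> x = e"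
    if A: "finite A" "independent A" "{q} \<subseteq> A" for A c b e
  proof -
    \<comment> \<open>\<open>z\<close> is orthogonal to \<open>A\<close>; requiring
      \<open>x \<cdot> z = 1\<close> keeps \<open>x\<close> outside \<open>span A\<close>, also
      after the correction by \<open>y\<close>.\<close>
    obtain z where z: "z \<notin> span A" "\<And>a. a \<in> A \<Longrightarrow> z \<cdot> a = 0"
      using exists_point_independent[OF A(1,2), of "\<lambda>_. 0"] by blast
    have zA: "finite (insert z A)" "independent (insert z A)"
      using A z(1) by (simp_all add: independent_insertI)
    have zn: "z \<notin> A" using z(1) span_base by blast
    obtain x where "\<forall>a\<in>insert z A. x \<cdot> a = (if a = z then 1 else if a = q then b else c a)"
      using exists_point_independent[OF zA, of "\<lambda>a. if a = z then 1 else if a = q then b else c a"]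
      by blast
    then have x: "x \<cdot> z = 1" "x \<cdot> q = b" "\<And>a. a \<in> A - {q} \<Longrightarrow> x \<cdot> a = c a"
      using A(3) zn by auto
    have "\<exists>y. (\<forall>a\<in>insert z A. y \<cdot> a = 0) \<and> \<phi> y = 1"
    proof (rule ccontr)
      assume "\<not> ?thesis"
      then have van: "\<phi> y = 0" if "\<And>a. a \<in> insert z A \<Longrightarrow> y \<cdot> a = 0" for y
        using that by (metis bit_not_zero_iff)
      show False
        by (rule functional_eq_dot[OF zA, of \<phi>, OF add van]) (use False in auto)
    qed
    then obtain y where y: "\<And>a. a \<in> insert z A \<Longrightarrow> y \<cdot> a = 0" "\<phi> y = 1" by blast
    define x' where "x' = (if \<phi> x = e then x else x + y)"
    have x': "x' \<cdot> a = x \<cdot> a" if "a \<in> insert z A" for a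
      using that y(1) by (simp add: x'_def dot_add_left)
    have "\<phi> x' = e" using y(2) by (cases e; cases "\<phi> x") (simp_all add: x'_def add)
    moreover have "x' \<notin> span A"
    proof
      assume "x' \<in> span A"
      then have "x' \<cdot> z = 0"
        by (rule additive_eq_on_span[where k = "\<lambda>_. 0", rotated -1])
           (use z(2) in \<open>auto simp: dot_add_right dot_commute[of _ z]\<close>)
      then show False using x'[of z] x(1) by simp
    qed
    moreover have "x' \<cdot> q = b" "\<forall>a\<in>A - {q}. x' \<cdot> a = c a" using x' x A(3) by auto
    ultimately show ?thesis by blast
  qed
  then show ?thesis using that[of "{q}"] q by (simp add: independent_insertI)
qed

text \<open>The copy is chosen point by point, each new point with the old products and the
  prescribed values of \<open>\<phi>\<close> and of the product with \<open>q\<close>. Keeping the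
  copy independent of \<open>R\<close> makes these conditions free.\<close>

lemma Sp_copy:
  assumes add: "\<And>x y. \<phi> (x + y) = \<phi> x + (\<phi> y :: bit)"
    and \<phi>1: "\<phi> u = 1" and q: "q \<noteq> 0" and \<phi>q: "\<phi> v \<noteq> v \<cdot> q"
    and A: "finite A" "independent A"
  shows "\<exists>s\<in>Sp scale P. \<forall>a\<in>A. \<phi> (s a) = \<alpha> a \<and> s a \<cdot> q = \<beta> a"
proof -
  obtain R where R: "finite R" "independent R" "q \<in> R"
    and point: "\<And>A c b e. finite A \<Longrightarrow> independent A \<Longrightarrow> R \<subseteq> A \<Longrightarrow>
       \<exists>x. x \<notin> span A \<and> (\<forall>a\<in>A - R. x \<cdot> a = c a) \<and> x \<cdot> q = b \<and> \<phi> x = e"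
    by (rule exists_point_functional[of \<phi>, OF add \<phi>1 q \<phi>q]) blast
  have "\<exists>w. inj_on w A \<and> independent (R \<union> w ` A) \<and> w ` A \<inter> R = {} \<and>
    (\<forall>a\<in>A. \<forall>b\<in>A. w a \<cdot> w b = a \<cdot> b) \<and> (\<forall>a\<in>A. \<phi> (w a) = \<alpha> a \<and> w a \<cdot> q = \<beta> a)"
    using A(1)
  proof (induction A rule: finite_induct)
    case empty
    then show ?case using R by simp
  next
    case (insert e A)
    then obtain w where w: "inj_on w A" "independent (R \<union> w ` A)" "w ` A \<inter> R = {}"
      "\<And>a b. a \<in> A \<Longrightarrow> b \<in> A \<Longrightarrow> w a \<cdot> w b = a \<cdot> b"
      "\<And>a. a \<in> A \<Longrightarrow> \<phi> (w a) = \<alpha> a \<and> w a \<cdot> q = \<beta> a" by blast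
    obtain x where x: "x \<notin> span (R \<union> w ` A)" "\<phi> x = \<alpha> e" "x \<cdot> q = \<beta> e"
      "\<And>a. a \<in> R \<union> w ` A - R \<Longrightarrow> x \<cdot> a = e \<cdot> inv_into A w a"
      using point[of "R \<union> w ` A" "\<lambda>a. e \<cdot> inv_into A w a" "\<beta> e" "\<alpha> e"] w(2) R(1) insert.hyps(1)
      by blast
    have xw: "x \<cdot> w a = e \<cdot> a" if "a \<in> A" for a
      using x(4)[of "w a"] that w(1,3) by auto
    have xn: "x \<notin> R \<union> w ` A" using x(1) by (rule contrapos_nn) (rule span_base)
    define w' where "w' = w(e := x)"
    have w': "w' a = w a" if "a \<in> A" for a using that insert.hyps(2) by (auto simp: w'_def)
    have w'e: "w' e = x" by (simp add: w'_def)
    have w'A: "w' ` A = w ` A" using w' by (rule image_cong[OF refl])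
    then have im: "w' ` insert e A = insert x (w ` A)" by (simp add: w'e)
    have "inj_on w' A" using w(1) inj_on_cong[of A w' w, OF w'] by simp
    then have "inj_on w' (insert e A)" using xn w'A insert.hyps(2) by (simp add: w'e)
    moreover have "independent (R \<union> w' ` insert e A)"
      unfolding im using w(2) x(1) by (simp add: independent_insertI)
    moreover have "w' ` insert e A \<inter> R = {}" unfolding im using w(3) xn by blast
    moreover have "w' a \<cdot> w' b = a \<cdot> b" if "a \<in> insert e A" "b \<in> insert e A" for a b
      using that by (auto simp: w' w'e w(4) xw dot_commute[of _ x] dot_commute[of _ e])
    moreover have "\<phi> (w' a) = \<alpha> a \<and> w' a \<cdot> q = \<beta> a" if "a \<in> insert e A" for a
      using that by (auto simp: w' w'e w(5) x)
    ultimately show ?case by blast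
  qed
  then obtain w where w: "inj_on w A" "independent (R \<union> w ` A)"
      "\<And>a b. a \<in> A \<Longrightarrow> b \<in> A \<Longrightarrow> w a \<cdot> w b = a \<cdot> b"
      "\<And>a. a \<in> A \<Longrightarrow> \<phi> (w a) = \<alpha> a \<and> w a \<cdot> q = \<beta> a" by blast
  have "\<exists>s\<in>Sp scale P. \<forall>a\<in>A. s a = w a"
    using Sp_extend_independent[OF A w(1) _ w(3)] w(2) independent_mono by blast
  then show ?thesis using w(4) by metis
qed

text \<open>The last hypothesis says that \<open>g\<close> conjugates the transvection along
  \<open>p\<close> into the one along \<open>g p\<close>; at \<open>x = g y\<close> it reads
  \<open>y \<cdot> p = g y \<cdot> g p\<close>.\<close>

lemma Sp_if_transvections_conjugate:
  assumes "bij g" "\<And>x y. g (x + y) = g x + g y" "\<And>p x. finv g x \<cdot> p = x \<cdot> g p"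
  shows "g \<in> Sp scale P"
  using assms(1,2) assms(3)[of "g _"] by (simp add: Sp_iff bij_is_inj)

lemma span_eq_sum:
  assumes "finite A" "x \<in> span A"
  shows "\<exists>A0\<subseteq>A. x = \<Sum>A0"
  using assms
proof (induction A arbitrary: x rule: finite_induct)
  case (insert a A)
  from insert.prems consider "x \<in> span A" | y where "y \<in> span A" "x = a + y"
    by (auto simp: span_insert_bit)
  then show ?case
  proof cases
    case 1
    then show ?thesis using insert.IH by blast
  next
    case 2
    then obtain A0 where A0: "A0 \<subseteq> A" "y = \<Sum>A0" using insert.IH by blast
    then have "x = \<Sum>(insert a A0)"
      using 2 insert.hyps finite_subset[OF A0(1)] by (subst sum.insert) auto
    then show ?thesis using A0(1) by blast
  qed
qed auto

lemma not_in_span_remove: "independent A \<Longrightarrow> a \<in> A \<Longrightarrow> a \<notin> span (A - {a})"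
  by (auto simp: dependent_def)

lemma id_in_Sp: "id \<in> Sp scale P"
  by (simp add: Sp_iff)

section \<open>Independent triples and pairs\<close>

text \<open>
  With \<open>eq_null\<close>, equations and inequations in characteristic 2 are brought to a normal form in which
  all summands are on one side.
\<close>
definition null :: "'v \<Rightarrow> bool" where "null x \<longleftrightarrow> x = 0"

lemma eq_null: "x = y \<longleftrightarrow> null (x + y)"
  by (simp add: null_def add_eq_0_iff_eq)

lemma null_0 [simp]: "null 0"
  by (simp add: null_def)

text \<open>Listing the seven combinations makes independence of explicit triples decidable by
  rewriting with \<open>eq_null\<close>; distinctness is included.\<close>

definition indep3 :: "'v \<Rightarrow> 'v \<Rightarrow> 'v \<Rightarrow> bool" where
  "indep3 x y z \<longleftrightarrow> \<not> null x \<and> \<not> null y \<and> \<not> null z \<and> \<not> null (x + y) \<and> \<not> null (x + z) \<and>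
    \<not> null (y + z) \<and> \<not> null (x + y + z)"

lemma indep3_iff: "indep3 x y z \<longleftrightarrow> card {x, y, z} = 3 \<and> independent {x, y, z}"
proof -
  have "card {x, y, z} = 3 \<longleftrightarrow> x \<noteq> y \<and> x \<noteq> z \<and> y \<noteq> z"
    by (auto simp: card_insert_if)
  then show ?thesis
    unfolding indep3_def
    by (auto simp: independent_insert span_insert_bit image_Un image_image)
       (simp_all add: eq_null ac_simps)
qed

lemma Sp_extend_indep3:
  assumes "indep3 a b c" "indep3 a' b' c'"
    "a \<cdot> b = a' \<cdot> b'" "b \<cdot> c = b' \<cdot> c'" "a \<cdot> c = a' \<cdot> c'"
  shows "\<exists>s\<in>Sp scale P. s a = a' \<and> s b = b' \<and> s c = c'"
proof -
  define f where "f = (\<lambda>x. c')(b := b', a := a')"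
  have ne: "a \<noteq> b" "a \<noteq> c" "b \<noteq> c" "a' \<noteq> b'" "a' \<noteq> c'" "b' \<noteq> c'"
    using assms(1,2) by (simp_all add: indep3_def eq_null ac_simps)
  have f: "f a = a'" "f b = b'" "f c = c'" using ne by (simp_all add: f_def)
  have "\<exists>s\<in>Sp scale P. \<forall>v\<in>{a, b, c}. s v = f v"
  proof (rule Sp_extend_independent)
    show "inj_on f {a, b, c}" using ne by (auto simp: f)
    show "independent {a, b, c}" "independent (f ` {a, b, c})"
      using assms(1,2) by (simp_all add: f indep3_iff)
    show "f v \<cdot> f w = v \<cdot> w" if "v \<in> {a, b, c}" "w \<in> {a, b, c}" for v w
      using that assms(3-5) by (auto simp: f dot_commute[of b a] dot_commute[of b' a']
         dot_commute[of c a] dot_commute[of c' a'] dot_commute[of c b] dot_commute[of c' b'])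
  qed simp
  then show ?thesis by (simp add: f)
qed

lemma Sp_extend_pair:
  assumes "a \<noteq> 0" "b \<noteq> 0" "a \<noteq> b" "a' \<noteq> 0" "b' \<noteq> 0" "a' \<noteq> b'" "a \<cdot> b = a' \<cdot> b'"
  shows "\<exists>s\<in>Sp scale P. s a = a' \<and> s b = b'"
proof -
  define f where "f = (\<lambda>x. b')(a := a')"
  have f: "f a = a'" "f b = b'" using assms by (simp_all add: f_def)
  have "\<exists>s\<in>Sp scale P. \<forall>v\<in>{a, b}. s v = f v"
  proof (rule Sp_extend_independent)
    show "inj_on f {a, b}" using assms by (auto simp: f)
    show "independent {a, b}" "independent (f ` {a, b})"
      using assms by (simp_all add: f independent_pair)
    show "f v \<cdot> f w = v \<cdot> w" if "v \<in> {a, b}" "w \<in> {a, b}" for v w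
      using that assms(7) by (auto simp: f dot_commute[of b a] dot_commute[of b' a'])
  qed simp
  then show ?thesis by (simp add: f)
qed

lemma exists_fourth:
  assumes "indep3 x y z"
  obtains w where "w \<cdot> x = p" "w \<cdot> y = q" "w \<cdot> z = r" "w \<notin> span {x, y, z}"
proof -
  have ne: "x \<noteq> y" "x \<noteq> z" "y \<noteq> z"
    using assms by (simp_all add: indep3_def eq_null ac_simps)
  obtain w where w: "w \<notin> span ({x, y, z} \<union> {})"
    "\<And>a. a \<in> {x, y, z} \<Longrightarrow> w \<cdot> a = (if a = x then p else if a = y then q else r)"
    using exists_point[of "{}" "{x, y, z}" "\<lambda>a. if a = x then p else if a = y then q else r"] assms
    unfolding indep3_iff by auto
  show ?thesis using w(1) w(2)[of x] w(2)[of y] w(2)[of z] ne by (intro that[of w]) auto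
qed

lemma not_in_span3:
  "w \<notin> span {x, y, z} \<longleftrightarrow> \<not> null w \<and> \<not> null (w + x) \<and> \<not> null (w + y) \<and> \<not> null (w + z) \<and>
    \<not> null (w + x + y) \<and> \<not> null (w + x + z) \<and> \<not> null (w + y + z) \<and> \<not> null (w + x + y + z)"
  by (auto simp: span_insert_bit image_Un image_image) (simp_all add: eq_null ac_simps)

end

subsection \<open>Linear closed overgroups\<close>

text \<open>Phrased with \<open>\<circ>\<close> and \<open>finv\<close> instead of the group record
  of \<open>Sym\<close>; \<open>closed_overgroup_iff\<close> gives the equivalence.\<close>

locale closed_overgroup = fraisse_limit scale P
  for scale :: "bit \<Rightarrow> 'v::ab_group_add \<Rightarrow> 'v" and P :: "bit \<Rightarrow> 'v \<Rightarrow> 'v \<Rightarrow> bool" +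
  fixes G :: "('v \<Rightarrow> 'v) set"
  assumes bij: "g \<in> G \<Longrightarrow> bij g"
    and comp: "g \<in> G \<Longrightarrow> h \<in> G \<Longrightarrow> g \<circ> h \<in> G"
    and inv: "g \<in> G \<Longrightarrow> finv g \<in> G"
    and Sp_subset: "Sp scale P \<subseteq> G"
    and closed: "bij \<pi> \<Longrightarrow> (\<And>S. finite S \<Longrightarrow> \<exists>\<sigma>\<in>G. \<forall>x\<in>S. \<sigma> x = \<pi> x) \<Longrightarrow> \<pi> \<in> G"
begin

lemma inv_left [simp]: "g \<in> G \<Longrightarrow> finv g (g x) = x"
  using bij by (simp add: bij_is_inj)

lemma inv_right [simp]: "g \<in> G \<Longrightarrow> g (finv g x) = x"
  using bij by (simp add: bij_is_surj surj_f_inv_f)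

lemma inj: "g \<in> G \<Longrightarrow> inj g"
  using bij by (rule bij_is_inj)

lemma eq_iff [simp]: "g \<in> G \<Longrightarrow> g x = g y \<longleftrightarrow> x = y"
  by (metis inv_left)

lemma Sp_in: "s \<in> Sp scale P \<Longrightarrow> s \<in> G"
  using Sp_subset by blast

text \<open>
  Induction on the number of nonzero products within the image of \<open>A\<close>: a copy of this image is chosen
  such that the map \<open>T\<close> changes exactly one of them.
\<close>
lemma linear_isotropic_image:
  assumes lin: "\<And>g x y. g \<in> G \<Longrightarrow> g (x + y) = g x + g y"
    and g: "g \<in> G" "g \<notin> Sp scale P"
    and A: "finite A" "independent A"
  shows "\<exists>h\<in>G. \<forall>a\<in>A. \<forall>b\<in>A. h a \<cdot> h b = 0"
proof -
  obtain p v where pv: "finv g v \<cdot> p \<noteq> v \<cdot> g p"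
    using Sp_if_transvections_conjugate[OF bij[OF g(1)] lin[OF g(1)]] g(2) by blast
  define \<phi> q where "\<phi> x = finv g x \<cdot> p" and "q = g p" for x
  have g0: "g 0 = 0" using additive_zero[of g, OF lin[OF g(1)]] .
  have \<phi>_add: "\<phi> (x + y) = \<phi> x + \<phi> y" for x y
    by (simp add: \<phi>_def lin inv g dot_add_left)
  have "p \<noteq> 0" using pv g0 by auto
  have "q \<noteq> 0" using eq_iff[OF g(1), of p 0] g0 \<open>p \<noteq> 0\<close> by (simp add: q_def)
  obtain u' where "u' \<cdot> p \<noteq> 0" using nondegenerate[of p] \<open>p \<noteq> 0\<close> dot_commute by metis
  then have u: "\<phi> (g u') = 1" by (simp add: \<phi>_def g)
  \<comment> \<open>The conjugate by \<open>g\<close> of the transvection along \<open>p\<close>. By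
    the choice of \<open>p\<close>, the functional \<open>\<phi>\<close> differs from the product
    with \<open>q\<close>.\<close>
  define T where "T = g \<circ> (\<lambda>x. x + scale (x \<cdot> p) p) \<circ> finv g"
  have "T \<in> G" unfolding T_def using g(1) Sp_in[OF transvection_in_Sp] comp inv by blast
  have T: "T x = x + scale (\<phi> x) q" for x
    by (simp add: T_def \<phi>_def q_def lin g scale_bit g0)
  define E where "E h = {(c, e) \<in> A \<times> A. h c \<cdot> h e = 1}" for h
  have fin: "finite (E h)" for h unfolding E_def using A(1) by (auto intro: finite_subset[of _ "A \<times> A"])
  have "\<exists>k\<in>G. E k = {}" if "h \<in> G" for h
    using that
  proof (induction "card (E h)" arbitrary: h rule: less_induct)
    case less
    show ?case
    proof (cases "E h = {}")
      case False
      then obtain a b where ab: "a \<in> A" "b \<in> A" "h a \<cdot> h b = 1" by (auto simp: E_def)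
      have hA: "independent (h ` A)"
        using independent_image_additive[of h A] lin less.prems A bij by (simp add: bij_is_inj)
      \<comment> \<open>\<open>T x \<cdot> T y\<close> differs from \<open>x \<cdot> y\<close> by
        \<open>\<phi> x * (q \<cdot> y) + \<phi> y * (x \<cdot> q)\<close>. With the values
        prescribed here only the product of \<open>h a\<close> and \<open>h b\<close> changes, and
        it becomes 0.\<close>
      obtain s where s: "s \<in> Sp scale P"
        "\<And>v. v \<in> h ` A \<Longrightarrow> \<phi> (s v) = (if v = h a then 1 else 0)"
        "\<And>v. v \<in> h ` A \<Longrightarrow> s v \<cdot> q = (if v = h b then 1 else 0)"
        using Sp_copy[of \<phi> _ q v "h ` A" "\<lambda>v. if v = h a then 1 else 0" "\<lambda>v. if v = h b then 1 else 0",
          OF \<phi>_add u \<open>q \<noteq> 0\<close> _ _ hA] pv A(1) unfolding \<phi>_def q_def by auto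
      define k where "k = T \<circ> s \<circ> h"
      have "k \<in> G" unfolding k_def using less.prems \<open>T \<in> G\<close> Sp_in[OF s(1)] comp by blast
      have k: "k c \<cdot> k e = h c \<cdot> h e + (if c = a \<and> e = b \<or> c = b \<and> e = a then 1 else 0)"
        if "c \<in> A" "e \<in> A" for c e
      proof -
        have "a \<noteq> b" using ab(3) by auto
        moreover have "s (h c) \<cdot> s (h e) = h c \<cdot> h e" using s(1) by (simp add: Sp_iff)
        ultimately show ?thesis
          using that s(2,3)[of "h c"] s(2,3)[of "h e"] less.prems
          by (auto simp: k_def T scale_bit dot_add_left dot_add_right dot_commute[of q "s _"])
      qed
      have "E k \<subset> E h"
      proof (rule psubsetI)
        show "E k \<subseteq> E h" using ab dot_commute[of "h a"]
          by (auto simp: E_def k split: if_splits)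
        have "(a, b) \<in> E h" "(a, b) \<notin> E k" using ab k[of a b] by (simp_all add: E_def)
        then show "E k \<noteq> E h" by blast
      qed
      then show ?thesis using less.hyps[OF psubset_card_mono[OF fin] \<open>k \<in> G\<close>] by blast
    qed (use less.prems in blast)
  qed
  then obtain k where "k \<in> G" "E k = {}" using g(1) by blast
  then show ?thesis unfolding E_def by (intro bexI[of _ k]) auto
qed

text \<open>For a basis \<open>A\<close> of the span of a finite set, \<open>g1\<close> and
  \<open>g2\<close> make \<open>A\<close> and its image under \<open>\<pi>\<close> isotropic. All
  products being 0, an element of \<open>Sp\<close> matches the two isotropic sets, and the
  resulting element of \<open>G\<close> agrees with \<open>\<pi>\<close> on the span by
  linearity.\<close>

lemma GL_subset:
  assumes lin: "\<And>g x y. g \<in> G \<Longrightarrow> g (x + y) = g x + g y" and "G \<noteq> Sp scale P"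
  shows "GL scale \<subseteq> G"
proof
  fix \<pi> assume "\<pi> \<in> GL scale"
  then have \<pi>: "bij \<pi>" "\<And>x y. \<pi> (x + y) = \<pi> x + \<pi> y"
    by (auto simp: GL_def carrier_Sym linear_iff_additive)
  obtain g where g: "g \<in> G" "g \<notin> Sp scale P" using assms(2) Sp_subset by blast
  have iso: "\<exists>h\<in>G. \<forall>a\<in>A. \<forall>b\<in>A. h a \<cdot> h b = 0" if "finite A" "independent A" for A
    by (rule linear_isotropic_image[OF _ g that]) (rule lin)
  show "\<pi> \<in> G"
  proof (rule closed[OF \<pi>(1)])
    fix S :: "'v set" assume "finite S"
    then obtain A where A: "finite A" "independent A" "span A = span S" using finite_basis by metis
    obtain g1 where g1: "g1 \<in> G" "\<And>a b. a \<in> A \<Longrightarrow> b \<in> A \<Longrightarrow> g1 a \<cdot> g1 b = 0"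
      using iso[OF A(1,2)] by blast
    have \<pi>A: "finite (\<pi> ` A)" "independent (\<pi> ` A)"
      using A independent_image_additive[of \<pi>, OF \<pi>(2) bij_is_inj[OF \<pi>(1)]] by simp_all
    obtain g2 where g2: "g2 \<in> G" "\<And>a b. a \<in> A \<Longrightarrow> b \<in> A \<Longrightarrow> g2 (\<pi> a) \<cdot> g2 (\<pi> b) = 0"
      using iso[OF \<pi>A] by blast
    define f where "f v = g2 (\<pi> (finv g1 v))" for v
    have f: "f (g1 a) = g2 (\<pi> a)" for a using g1 by (simp add: f_def)
    have "\<exists>s\<in>Sp scale P. \<forall>v\<in>g1 ` A. s v = f v"
    proof (rule Sp_extend_independent)
      show "independent (g1 ` A)"
        using A independent_image_additive[of g1, OF lin[OF g1(1)] inj[OF g1(1)]] by simp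
      have "f ` g1 ` A = g2 ` \<pi> ` A" using f by (simp add: image_image)
      then show "independent (f ` g1 ` A)"
        using \<pi>A independent_image_additive[of g2, OF lin[OF g2(1)] inj[OF g2(1)]] by simp
      show "inj_on f (g1 ` A)"
        using \<pi>(1) g1(1) g2(1) by (auto simp: inj_on_def f bij_is_inj[THEN inj_eq])
    qed (use A f g1 g2 in auto)
    then obtain s where s: "s \<in> Sp scale P" "\<And>a. a \<in> A \<Longrightarrow> s (g1 a) = g2 (\<pi> a)" using f by auto
    define \<sigma> where "\<sigma> = finv g2 \<circ> s \<circ> g1"
    have "\<sigma> \<in> G" unfolding \<sigma>_def using g1(1) g2(1) Sp_in[OF s(1)] by (intro comp inv)
    moreover have "\<sigma> x = \<pi> x" if "x \<in> span A" for x
      using that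
      by (rule additive_eq_on_span[rotated -1]) (use lin[OF \<open>\<sigma> \<in> G\<close>] \<pi> s g2 in \<open>auto simp: \<sigma>_def\<close>)
    ultimately show "\<exists>\<sigma>\<in>G. \<forall>x\<in>S. \<sigma> x = \<pi> x" using A(3) span_base by metis
  qed
qed

section \<open>Orbits of pointwise stabilizers\<close>

definition same_orbit :: "'v set \<Rightarrow> 'v \<Rightarrow> 'v \<Rightarrow> bool" where
  "same_orbit A x y \<longleftrightarrow> (\<exists>g\<in>G. (\<forall>a\<in>A. g a = a) \<and> g x = y)"

lemma same_orbit_refl: "same_orbit A x x"
  unfolding same_orbit_def by (rule bexI[OF _ Sp_in[OF id_in_Sp]]) simp

lemma same_orbit_sym:
  assumes "same_orbit A x y"
  shows "same_orbit A y x"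
proof -
  obtain g where g: "g \<in> G" "\<forall>a\<in>A. g a = a" "g x = y" using assms by (auto simp: same_orbit_def)
  have "finv g a = a" if "a \<in> A" for a using inv_left[OF g(1), of a] g(2) that by simp
  then show ?thesis
    unfolding same_orbit_def using g by (intro bexI[OF _ inv[OF g(1)]]) auto
qed

lemma same_orbit_trans:
  assumes "same_orbit A x y" "same_orbit A y z"
  shows "same_orbit A x z"
proof -
  obtain g h where "g \<in> G" "\<forall>a\<in>A. g a = a" "g x = y" "h \<in> G" "\<forall>a\<in>A. h a = a" "h y = z"
    using assms by (auto simp: same_orbit_def)
  then show ?thesis unfolding same_orbit_def using comp[of h g] by (intro bexI[of _ "h \<circ> g"]) auto
qed

lemma same_orbit_mono: "same_orbit B x y \<Longrightarrow> A \<subseteq> B \<Longrightarrow> same_orbit A x y"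
  unfolding same_orbit_def by blast

lemma same_orbit_image:
  assumes "same_orbit A x y" "h \<in> G"
  shows "same_orbit (h ` A) (h x) (h y)"
proof -
  obtain g where g: "g \<in> G" "\<forall>a\<in>A. g a = a" "g x = y" using assms by (auto simp: same_orbit_def)
  have "h \<circ> g \<circ> finv h \<in> G" by (intro comp inv assms(2) g(1))
  then show ?thesis
    unfolding same_orbit_def using g assms(2) by (intro bexI[of _ "h \<circ> g \<circ> finv h"]) auto
qed

lemma same_orbit_dots:
  assumes "finite A" "x \<notin> span A" "y \<notin> span A" "\<And>a. a \<in> A \<Longrightarrow> x \<cdot> a = y \<cdot> a"
  shows "same_orbit (span A) x y"
  using Sp_transport[OF assms] Sp_in unfolding same_orbit_def by blast

end

subsection \<open>Closed overgroups fixing 0\<close>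

locale zero_fixing_overgroup = closed_overgroup scale P G
  for scale :: "bit \<Rightarrow> 'v::ab_group_add \<Rightarrow> 'v" and P :: "bit \<Rightarrow> 'v \<Rightarrow> 'v \<Rightarrow> bool"
    and G :: "('v \<Rightarrow> 'v) set" +
  assumes fixes_zero: "g \<in> G \<Longrightarrow> g 0 = 0"
begin

section \<open>Sets with an independent image, and minimal sets without one\<close>

definition spreadable :: "'v set \<Rightarrow> bool" where
  "spreadable S \<longleftrightarrow> (\<exists>g\<in>G. independent (g ` S))"

text \<open>Minimality is by cardinality among all sets, not by inclusion: any smaller set,
  contained in \<open>B\<close> or not, can then be spread, and minimality passes to images.\<close>

definition minimal_nonspreadable :: "'v set \<Rightarrow> bool" where
  "minimal_nonspreadable B \<longleftrightarrow> finite B \<and> 0 \<notin> B \<and> \<not> spreadable B \<and>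
    (\<forall>S. finite S \<longrightarrow> 0 \<notin> S \<longrightarrow> card S < card B \<longrightarrow> spreadable S)"

lemma eq_zero_iff: "g \<in> G \<Longrightarrow> g x = 0 \<longleftrightarrow> x = 0"
  by (metis eq_iff fixes_zero)

lemma spreadable_image:
  assumes "g \<in> G" "spreadable (g ` S)"
  shows "spreadable S"
proof -
  obtain h where h: "h \<in> G" "independent (h ` g ` S)" using assms by (auto simp: spreadable_def)
  then have "independent ((h \<circ> g) ` S)" by (simp only: image_comp not_False_eq_True)
  then show ?thesis unfolding spreadable_def using comp[OF h(1) assms(1)] by blast
qed

lemma independent_spreadable: "independent S \<Longrightarrow> spreadable S"
  unfolding spreadable_def by (rule bexI[OF _ Sp_in[OF id_in_Sp]]) simp

lemma minimal_nonspreadable_image: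
  assumes "g \<in> G" "minimal_nonspreadable B"
  shows "minimal_nonspreadable (g ` B)"
proof -
  have "card (g ` B) = card B" using inj[OF assms(1)] by (intro card_image) (auto intro: inj_on_subset)
  moreover have "0 \<notin> g ` B"
    using assms eq_zero_iff[OF assms(1)] by (force simp: minimal_nonspreadable_def)
  moreover have "\<not> spreadable (g ` B)"
    using assms spreadable_image[OF assms(1), of B] by (auto simp: minimal_nonspreadable_def)
  ultimately show ?thesis
    using assms(2) by (simp add: minimal_nonspreadable_def)
qed

text \<open>Only the finitely many points of \<open>F\<close> are sent by \<open>g\<close> into the
  span of the image of \<open>A\<close>. A symplectic map fixing \<open>A\<close> first moves
  \<open>c\<close> to a point \<open>y\<close> outside \<open>F\<close>.\<close>

lemma extend_spread:
  assumes "finite A" "g \<in> G" "independent (g ` A)" "c \<notin> span A"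
  shows "\<exists>h\<in>G. (\<forall>a\<in>A. h a = g a) \<and> independent (h ` insert c A)"
proof -
  define F where "F = finv g ` span (g ` A)"
  have "finite F" using assms(1) by (simp add: F_def finite_span)
  then obtain y where y: "y \<notin> span (insert c (A \<union> F))" "\<And>a. a \<in> span A \<Longrightarrow> y \<cdot> a = c \<cdot> a"
    using exists_point_like[of F A c] assms(1) by blast
  have "y \<notin> span A" using y(1) span_mono[of A "insert c (A \<union> F)"] by blast
  have "y \<notin> F" using y(1) span_base[of y "insert c (A \<union> F)"] by blast
  obtain s where s: "s \<in> Sp scale P" "\<And>a. a \<in> span A \<Longrightarrow> s a = a" "s c = y"
    using Sp_transport[OF assms(1,4) \<open>y \<notin> span A\<close>] y(2) span_base by metis
  have sA: "s a = a" if "a \<in> A" for a using s(2) that span_base by blast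
  have "g y \<notin> span (g ` A)"
  proof
    assume "g y \<in> span (g ` A)"
    then have "finv g (g y) \<in> F" unfolding F_def by (rule imageI)
    then show False using \<open>y \<notin> F\<close> assms(2) by simp
  qed
  moreover have "(g \<circ> s) ` A = g ` A" using sA by force
  ultimately have "independent ((g \<circ> s) ` insert c A)"
    using assms(3) s(3) by (simp add: independent_insertI)
  moreover have "g \<circ> s \<in> G" using comp[OF assms(2) Sp_in[OF s(1)]] .
  ultimately show ?thesis using sA by (intro bexI[of _ "g \<circ> s"]) auto
qed

text \<open>\<open>A\<close> itself may be dependent; only its image under \<open>g\<close> is
  independent, and each point of \<open>C\<close> has to be independent of all the other
  points.\<close>

lemma extend_spread_many:
  assumes "finite C" "finite A" "g \<in> G" "independent (g ` A)"
    and "\<And>c. c \<in> C \<Longrightarrow> c \<notin> span (A \<union> (C - {c}))"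
  shows "\<exists>h\<in>G. (\<forall>a\<in>A. h a = g a) \<and> independent (h ` (A \<union> C))"
  using assms(1,5)
proof (induction C rule: finite_induct)
  case empty
  then show ?case using assms by auto
next
  case (insert c C)
  have "e \<notin> span (A \<union> (C - {e}))" if "e \<in> C" for e
    using insert.prems[of e] that span_mono[of "A \<union> (C - {e})" "A \<union> (insert c C - {e})"] by blast
  then obtain h where h: "h \<in> G" "\<And>a. a \<in> A \<Longrightarrow> h a = g a" "independent (h ` (A \<union> C))"
    using insert.IH by blast
  have "c \<notin> span (A \<union> C)" using insert.prems[of c] insert.hyps(2) by simp
  then obtain k where "k \<in> G" "\<And>a. a \<in> A \<union> C \<Longrightarrow> k a = h a"
    "independent (k ` insert c (A \<union> C))"
    using extend_spread[of "A \<union> C" h c] h assms(2) insert.hyps(1) by blast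
  then show ?case using h(2) by (intro bexI[of _ k]) auto
qed

text \<open>If \<open>c\<close> were the sum of a proper subset \<open>A0\<close>, the smaller set
  \<open>insert c A0\<close> could be spread by minimality, and \<open>extend_spread_many\<close>
  would add the rest of \<open>A\<close>.\<close>

lemma minimal_nonspreadable_eq_sum:
  assumes B: "minimal_nonspreadable (insert c A)" and c: "c \<notin> A" and A: "independent A"
  shows "c = \<Sum>A"
proof -
  have fin: "finite A" using B by (simp add: minimal_nonspreadable_def)
  have "c \<in> span A"
    using B A independent_spreadable independent_insertI unfolding minimal_nonspreadable_def by blast
  then obtain A0 where A0: "A0 \<subseteq> A" "c = \<Sum>A0" using span_eq_sum fin by blast
  have "A0 = A"
  proof (rule ccontr)
    assume "A0 \<noteq> A"
    then have "card A0 < card A" using A0(1) fin by (intro psubset_card_mono) auto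
    moreover have "finite A0" "c \<notin> A0" using A0(1) fin c finite_subset by auto
    ultimately have "spreadable (insert c A0)"
      using B c fin A0(1) by (auto simp: minimal_nonspreadable_def)
    then obtain g where g: "g \<in> G" "independent (g ` insert c A0)" by (auto simp: spreadable_def)
    have "e \<notin> span (insert c A0 \<union> (A - A0 - {e}))" if "e \<in> A - A0" for e
    proof -
      have "A0 \<subseteq> A - {e}" using that A0(1) by blast
      then have "c \<in> span (A - {e})" unfolding A0(2) by (intro span_sum span_base) blast
      then have "insert c A0 \<union> (A - A0 - {e}) \<subseteq> span (A - {e})"
        using that \<open>A0 \<subseteq> A - {e}\<close> span_superset[of "A - {e}"] by blast
      then have "span (insert c A0 \<union> (A - A0 - {e})) \<subseteq> span (A - {e})"
        by (intro span_minimal) auto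
      then show ?thesis using not_in_span_remove[OF A, of e] that by blast
    qed
    then obtain h where "h \<in> G" "independent (h ` (insert c A0 \<union> (A - A0)))"
      using extend_spread_many[of "A - A0" "insert c A0" g] g fin \<open>finite A0\<close> by auto
    moreover have "insert c A0 \<union> (A - A0) = insert c A" using A0(1) by blast
    ultimately have "spreadable (insert c A)" unfolding spreadable_def by metis
    then show False using B by (simp add: minimal_nonspreadable_def)
  qed
  then show ?thesis using A0(2) by simp
qed

text \<open>The image is again minimal nonspreadable, so the sum formula holds there too. This is
  how minimality forces additivity of group elements.\<close>

lemma minimal_nonspreadable_image_eq_sum:
  assumes "minimal_nonspreadable (insert c A)" "c \<notin> A" "g \<in> G" "independent (g ` A)"
  shows "g c = (\<Sum>a\<in>A. g a)"
proof -
  have "g c = \<Sum>(g ` A)"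
    using minimal_nonspreadable_image[OF assms(3,1)] assms(2,3,4)
    by (intro minimal_nonspreadable_eq_sum) auto
  then show ?thesis using inj[OF assms(3)] by (simp add: sum.reindex inj_on_subset)
qed

text \<open>Removing one point leaves a set that can be spread; its independent image is
  \<open>A\<close>. Fewer than two points in \<open>A\<close> would give \<open>c = 0\<close> or
  \<open>c \<in> A\<close>.\<close>

lemma minimal_nonspreadable_normal_form:
  assumes "minimal_nonspreadable B"
  obtains c A where "minimal_nonspreadable (insert c A)" "c \<notin> A" "independent A" "c = \<Sum>A"
    "card B = Suc (card A)" "2 \<le> card A"
proof -
  have "B \<noteq> {}" using assms independent_spreadable[OF independent_empty]
    by (auto simp: minimal_nonspreadable_def)
  then obtain b where b: "b \<in> B" by blast
  have fin: "finite B" using assms by (simp add: minimal_nonspreadable_def)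
  have "card (B - {b}) < card B" using fin b by (rule card_Diff1_less)
  then have "spreadable (B - {b})" using assms by (auto simp: minimal_nonspreadable_def)
  then obtain g where g: "g \<in> G" "independent (g ` (B - {b}))" by (auto simp: spreadable_def)
  define A where "A = g ` (B - {b})"
  have B: "g ` B = insert (g b) A" using b by (auto simp: A_def)
  have M: "minimal_nonspreadable (insert (g b) A)"
    using minimal_nonspreadable_image[OF g(1) assms] B by simp
  have n: "g b \<notin> A" using g(1) by (auto simp: A_def)
  have A: "independent A" using g(2) by (simp add: A_def)
  have sum: "g b = \<Sum>A" using minimal_nonspreadable_eq_sum[OF M n A] .
  have finA: "finite A" using fin by (simp add: A_def)
  have card: "card B = Suc (card A)"
    unfolding A_def card_image[OF inj_on_subset[OF inj[OF g(1)] subset_UNIV]]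
    by (rule card.remove[OF fin b])
  have "2 \<le> card A"
  proof (rule ccontr)
    assume "\<not> 2 \<le> card A"
    then consider "card A = 0" | "card A = 1" by linarith
    then show False
    proof cases
      case 1
      then show False using finA sum M by (auto simp: minimal_nonspreadable_def)
    next
      case 2
      then show False using sum n by (auto simp: card_1_singleton_iff)
    qed
  qed
  then show ?thesis using that[OF M n A sum card] by blast
qed

section \<open>Minimal nonspreadable sets of three points\<close>

definition bad_line :: "'v \<Rightarrow> 'v \<Rightarrow> bool" where
  "bad_line x y \<longleftrightarrow> x \<noteq> 0 \<and> y \<noteq> 0 \<and> x \<noteq> y \<and> minimal_nonspreadable {x, y, x + y}"

lemma bad_line_add:
  assumes "bad_line x y" "g \<in> G"
  shows "g (x + y) = g x + g y"
proof -
  have xy: "x \<noteq> 0" "y \<noteq> 0" "x \<noteq> y" and M: "minimal_nonspreadable (insert (x + y) {x, y})"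
    using assms(1) by (auto simp: bad_line_def insert_commute)
  have "g (x + y) = (\<Sum>a\<in>{x, y}. g a)"
  proof (rule minimal_nonspreadable_image_eq_sum[OF M _ assms(2)])
    show "x + y \<notin> {x, y}" using xy by simp
    show "independent (g ` {x, y})" using xy assms(2) by (simp add: independent_pair eq_zero_iff)
  qed
  then show ?thesis using xy by simp
qed

lemma bad_line_image:
  assumes "bad_line x y" "g \<in> G"
  shows "bad_line (g x) (g y)"
  using minimal_nonspreadable_image[OF assms(2), of "{x, y, x + y}"] assms bad_line_add[OF assms]
  by (auto simp: bad_line_def eq_zero_iff)

lemma bad_line_transport:
  assumes "bad_line x y" "x' \<noteq> 0" "y' \<noteq> 0" "x' \<noteq> y'" "x \<cdot> y = x' \<cdot> y'"
  shows "bad_line x' y'"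
proof -
  obtain s where "s \<in> Sp scale P" "s x = x'" "s y = y'"
    using Sp_extend_pair[of x y x' y'] assms by (auto simp: bad_line_def)
  then show ?thesis using bad_line_image[OF assms(1) Sp_in] by blast
qed

text \<open>Up to \<open>Sp\<close>, pairs of distinct nonzero vectors are classified by their
  product. If bad lines occur for both values, every pair is bad. If for one value only, badness
  encodes the product, so \<open>G\<close> preserves the form. Either way \<open>g\<close> is
  additive.\<close>

lemma bad_line_additive:
  assumes L: "bad_line x0 y0" and g: "g \<in> G"
  shows "g (x + y) = g x + g y"
proof -
  consider "x = 0 \<or> y = 0 \<or> x = y" | "x \<noteq> 0" "y \<noteq> 0" "x \<noteq> y" by blast
  then show ?thesis
  proof cases
    case 1
    then show ?thesis using fixes_zero[OF g] by auto
  next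
    case xy: 2
    show ?thesis
    proof (cases "\<exists>x1 y1. bad_line x1 y1 \<and> x1 \<cdot> y1 \<noteq> x0 \<cdot> y0")
      case True
      then obtain x1 y1 where L1: "bad_line x1 y1" "x1 \<cdot> y1 \<noteq> x0 \<cdot> y0" by blast
      have "x \<cdot> y = x0 \<cdot> y0 \<or> x \<cdot> y = x1 \<cdot> y1"
        using L1(2) by (metis bit_not_zero_iff)
      then have "bad_line x y"
        using bad_line_transport[OF L xy] bad_line_transport[OF L1(1) xy] by auto
      then show ?thesis using bad_line_add g by blast
    next
      case False
      have iff: "bad_line u v \<longleftrightarrow> u \<cdot> v = x0 \<cdot> y0" if "u \<noteq> 0" "v \<noteq> 0" "u \<noteq> v" for u v
        using False bad_line_transport[OF L that] by auto
      have pres: "h u \<cdot> h v = x0 \<cdot> y0" if "h \<in> G" "u \<cdot> v = x0 \<cdot> y0" "u \<noteq> 0" "v \<noteq> 0" "u \<noteq> v" for h u v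
        using bad_line_image[of u v h] iff[of u v] iff[of "h u" "h v"] that by (simp add: eq_zero_iff)
      have dot: "g u \<cdot> g v = u \<cdot> v" for u v
      proof (cases "u = 0 \<or> v = 0 \<or> u = v")
        case True
        then show ?thesis using fixes_zero[OF g] by auto
      next
        case False
        then have "u \<cdot> v = x0 \<cdot> y0 \<longleftrightarrow> g u \<cdot> g v = x0 \<cdot> y0"
          using pres[OF g, of u v] pres[OF inv[OF g], of "g u" "g v"] g by (auto simp: eq_zero_iff)
        then show ?thesis by (metis bit_not_zero_iff)
      qed
      then show ?thesis using dot_preserving_in_Sp[OF bij[OF g]] by (simp add: Sp_iff)
    qed
  qed
qed

section \<open>Minimal nonspreadable sets of four points\<close>

lemma bad_quadruple_add:
  assumes M: "minimal_nonspreadable {a, b, c, a + b + c}" and abc: "indep3 a b c" and g: "g \<in> G"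
  shows "g (a + b + c) = g a + g b + g c"
proof -
  define d where "d = a + b + c"
  have M': "minimal_nonspreadable (insert d {a, b, c})"
    using M by (simp add: d_def insert_commute)
  have ne: "a \<noteq> 0" "b \<noteq> 0" "c \<noteq> 0" "a \<noteq> b" "a \<noteq> c" "b \<noteq> c" "d \<noteq> 0" "d \<noteq> a" "d \<noteq> b" "d \<noteq> c"
    using abc by (simp_all add: indep3_def eq_null d_def ac_simps)
  show ?thesis
  proof (cases "independent (g ` {a, b, c})")
    case True
    then have "g d = (\<Sum>x\<in>{a, b, c}. g x)"
      using M' g ne by (intro minimal_nonspreadable_image_eq_sum) auto
    then show ?thesis using ne by (simp add: d_def ac_simps)
  next
    case False
    \<comment> \<open>A dependent image of the triple is a line, and \<open>g d\<close> lies off its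
      span. Since \<open>finv g\<close> spreads the line back to \<open>{a, b, c}\<close>,
      \<open>extend_spread\<close> would spread all four points.\<close>
    have "\<not> indep3 (g a) (g b) (g c)" using False by (simp add: indep3_iff)
    moreover have "\<not> null (g a)" "\<not> null (g b)" "\<not> null (g c)"
      "\<not> null (g a + g b)" "\<not> null (g a + g c)" "\<not> null (g b + g c)"
      using ne g by (simp_all add: eq_zero_iff null_def add_eq_0_iff_eq)
    ultimately have "g c = g a + g b" by (simp add: indep3_def eq_null ac_simps)
    then have "span (g ` {a, b, c}) \<subseteq> {0, g a, g b, g c}"
      by (intro span_minimal) (auto simp: subspace_iff ac_simps)
    then have "g d \<notin> span (g ` {a, b, c})"
      using ne g eq_zero_iff[OF g, of d] by auto
    moreover have "finv g ` g ` {a, b, c} = {a, b, c}" using g by simp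
    moreover have "independent {a, b, c}" using abc by (simp add: indep3_iff)
    ultimately obtain h where "h \<in> G" "independent (h ` insert (g d) (g ` {a, b, c}))"
      using extend_spread[of "g ` {a, b, c}" "finv g" "g d"] inv[OF g] by auto
    then have "spreadable (g ` insert d {a, b, c})" unfolding spreadable_def by auto
    then have "spreadable (insert d {a, b, c})" by (rule spreadable_image[OF g])
    then show ?thesis using M' by (simp add: minimal_nonspreadable_def)
  qed
qed

text \<open>
  By homogeneity, whether all of \<open>G\<close> preserves the sum of an independent triple depends only on the
  three products of its members.
\<close>
definition quad_type :: "bit \<Rightarrow> bit \<Rightarrow> bit \<Rightarrow> bool" where
  "quad_type p q r \<longleftrightarrow> (\<forall>a b c. indep3 a b c \<longrightarrow> a \<cdot> b = p \<longrightarrow> b \<cdot> c = q \<longrightarrow> a \<cdot> c = r \<longrightarrow>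
     (\<forall>g\<in>G. g (a + b + c) = g a + g b + g c))"

lemma quad_typeI:
  assumes abc: "indep3 a b c" and g: "\<And>g. g \<in> G \<Longrightarrow> g (a + b + c) = g a + g b + g c"
  shows "quad_type (a \<cdot> b) (b \<cdot> c) (a \<cdot> c)"
  unfolding quad_type_def
proof (intro allI impI ballI)
  fix a' b' c' g
  assume *: "indep3 a' b' c'" "a' \<cdot> b' = a \<cdot> b" "b' \<cdot> c' = b \<cdot> c" "a' \<cdot> c' = a \<cdot> c" "g \<in> G"
  obtain s where s: "s \<in> Sp scale P" "s a = a'" "s b = b'" "s c = c'"
    using Sp_extend_indep3[OF abc *(1)] *(2-4) by metis
  have "s (a + b + c) = a' + b' + c'" using s by (simp add: Sp_iff)
  then show "g (a' + b' + c') = g a' + g b' + g c'"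
    using g[OF comp[OF *(5) Sp_in[OF s(1)]]] s by simp
qed

lemma quad_typeD:
  assumes "quad_type p q r" "indep3 a b c" "a \<cdot> b = p" "b \<cdot> c = q" "a \<cdot> c = r" "g \<in> G"
  shows "g (a + b + c) = g a + g b + g c"
  using assms unfolding quad_type_def by blast

lemma indep3_perm: "indep3 a b c \<Longrightarrow> indep3 c b a" "indep3 a b c \<Longrightarrow> indep3 b a c"
  "indep3 a b c \<Longrightarrow> indep3 a b (a + b + c)" "indep3 a b c \<Longrightarrow> indep3 a b (a + c)"
  by (simp_all add: indep3_def ac_simps)

text \<open>The condition says that \<open>g\<close> preserves a zero sum, which is symmetric in
  \<open>a\<close>, \<open>b\<close>, \<open>c\<close>, \<open>a + b + c\<close>. The first two
  claims permute \<open>a\<close>, \<open>b\<close>, \<open>c\<close>; the third exchanges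
  \<open>c\<close> with the sum.\<close>

lemma quad_type_perm:
  assumes "quad_type p q r"
  shows "quad_type q p r" "quad_type p r q" "quad_type p (p + q) (p + r)"
proof -
  show "quad_type q p r" unfolding quad_type_def
  proof (intro allI impI ballI)
    fix a b c g assume *: "indep3 a b c" "a \<cdot> b = q" "b \<cdot> c = p" "a \<cdot> c = r" "g \<in> G"
    have "g (c + b + a) = g c + g b + g a"
      by (rule quad_typeD[OF assms indep3_perm(1)]) (use * in \<open>simp_all add: dot_commute\<close>)
    then show "g (a + b + c) = g a + g b + g c" by (simp add: ac_simps)
  qed
  show "quad_type p r q" unfolding quad_type_def
  proof (intro allI impI ballI)
    fix a b c g assume *: "indep3 a b c" "a \<cdot> b = p" "b \<cdot> c = r" "a \<cdot> c = q" "g \<in> G"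
    have "g (b + a + c) = g b + g a + g c"
      by (rule quad_typeD[OF assms indep3_perm(2)]) (use * in \<open>simp_all add: dot_commute\<close>)
    then show "g (a + b + c) = g a + g b + g c" by (simp add: ac_simps)
  qed
  show "quad_type p (p + q) (p + r)" unfolding quad_type_def
  proof (intro allI impI ballI)
    fix a b c g assume *: "indep3 a b c" "a \<cdot> b = p" "b \<cdot> c = p + q" "a \<cdot> c = p + r" "g \<in> G"
    have "g (a + b + (a + b + c)) = g a + g b + g (a + b + c)"
      by (rule quad_typeD[OF assms indep3_perm(3)])
         (use * in \<open>simp_all add: dot_add_right dot_commute[of b a]\<close>)
    moreover have "a + b + (a + b + c) = c" by (simp add: ac_simps)
    ultimately have "g c = g a + g b + g (a + b + c)" by simp
    then show "g (a + b + c) = g a + g b + g c" by (simp add: ac_simps)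
  qed
qed

text \<open>The condition \<open>x \<cdot> w = y \<cdot> w\<close> ensures that the translated pair
  again has product \<open>e\<close>.\<close>

definition translation_type :: "bit \<Rightarrow> bool" where
  "translation_type e \<longleftrightarrow> (\<forall>x y w. indep3 x y w \<longrightarrow> x \<cdot> y = e \<longrightarrow> x \<cdot> w = y \<cdot> w \<longrightarrow>
     (\<forall>g\<in>G. g x + g y = g (x + w) + g (y + w)))"

text \<open>The triple \<open>x\<close>, \<open>y\<close>, \<open>x + w\<close> has sum
  \<open>y + w\<close> and type \<open>1\<close>, \<open>1 + y \<cdot> w\<close>,
  \<open>y \<cdot> w\<close>, one of the two assumed types.\<close>

lemma translation_type_1:
  assumes "quad_type 1 1 0" "quad_type 1 0 1"
  shows "translation_type 1"
  unfolding translation_type_def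
proof (intro allI impI ballI)
  fix x y w g assume *: "indep3 x y w" "x \<cdot> y = 1" "x \<cdot> w = y \<cdot> w" "g \<in> G"
  have yx: "y \<cdot> x = 1" using *(2) dot_commute[of x y] by simp
  have "quad_type 1 (1 + y \<cdot> w) (y \<cdot> w)" using assms by (cases "y \<cdot> w") simp_all
  then have "g (x + y + (x + w)) = g x + g y + g (x + w)"
    by (rule quad_typeD[OF _ indep3_perm(4)]) (use * yx in \<open>simp_all add: dot_add_right\<close>)
  moreover have "x + y + (x + w) = y + w" by (simp add: ac_simps)
  ultimately show "g x + g y = g (x + w) + g (y + w)" by (simp add: ac_simps)
qed

lemma translation_type_0:
  assumes q1: "quad_type 0 k 0" and q2: "quad_type k 0 0"
  shows "translation_type 0"
  unfolding translation_type_def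
proof (intro allI impI ballI)
  fix x y w g assume *: "indep3 x y w" "x \<cdot> y = 0" "x \<cdot> w = y \<cdot> w" "g \<in> G"
  text \<open>Translating by \<open>w\<close> is translating by \<open>v\<close> and then by \<open>v + w\<close>.\<close>
  obtain v where v: "v \<cdot> x = 0" "v \<cdot> y = k" "v \<cdot> w = y \<cdot> w" "v \<notin> span {x, y, w}"
    by (rule exists_fourth[OF *(1)])
  have sym: "y \<cdot> x = 0" "x \<cdot> v = 0" "y \<cdot> v = k"
    using *(2) v dot_commute[of x y] dot_commute[of x v] dot_commute[of y v] by simp_all
  \<comment> \<open>The products of \<open>v\<close> are chosen to give \<open>x\<close>,
    \<open>y\<close>, \<open>x + v\<close> the type \<open>0 k 0\<close> and \<open>x + v\<close>,
    \<open>y + v\<close>, \<open>x + w\<close> the type \<open>k 0 0\<close>.\<close>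
  have "g (x + y + (x + v)) = g x + g y + g (x + v)"
    by (rule quad_typeD[OF q1])
       (use * v sym in \<open>simp_all add: indep3_def not_in_span3 dot_add_right ac_simps\<close>)
  moreover have "x + y + (x + v) = y + v" by (simp add: ac_simps)
  moreover have "g (x + v + (y + v) + (x + w)) = g (x + v) + g (y + v) + g (x + w)"
    by (rule quad_typeD[OF q2])
       (use * v sym in \<open>simp_all add: indep3_def not_in_span3 dot_add_right dot_add_left ac_simps\<close>)
  moreover have "x + v + (y + v) + (x + w) = y + w" by (simp add: ac_simps)
  ultimately show "g x + g y = g (x + w) + g (y + w)" by (simp add: ac_simps)
qed

text \<open>Under \<open>quad_type_perm\<close> the eight types form three classes, represented by
  \<open>0 0 0\<close>, \<open>1 0 0\<close> and \<open>1 1 0\<close>. The first two lead to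
  translation type 0, the third to 1.\<close>

lemma exists_translation_type:
  assumes "quad_type p q r"
  shows "\<exists>e. translation_type e"
proof -
  note perm = quad_type_perm
  have "quad_type 0 0 0 \<or> quad_type 1 0 0 \<or> quad_type 1 1 0 \<and> quad_type 1 0 1"
  proof -
    have *: "quad_type 0 1 0 \<Longrightarrow> quad_type 1 0 0" "quad_type 0 0 1 \<Longrightarrow> quad_type 0 1 0"
      "quad_type 1 1 1 \<Longrightarrow> quad_type 1 0 0" "quad_type 1 1 0 \<Longrightarrow> quad_type 1 0 1"
      "quad_type 1 0 1 \<Longrightarrow> quad_type 1 1 0" "quad_type 0 1 1 \<Longrightarrow> quad_type 1 0 1"
      using perm(1)[of 0 1 0] perm(2)[of 0 0 1] perm(3)[of 1 1 1] perm(3)[of 1 1 0]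
        perm(3)[of 1 0 1] perm(1)[of 0 1 1] by simp_all
    show ?thesis using assms * by (cases p; cases q; cases r) auto
  qed
  then show ?thesis
    using translation_type_0 translation_type_1 perm(1)[of 1 0 0] by blast
qed

text \<open>The additivity defect \<open>D\<close> takes the same value on all pairs of distinct
  nonzero vectors with product \<open>e\<close>; a nonzero constant value is then refuted.\<close>

lemma translation_type_add:
  assumes T: "translation_type e" and g: "g \<in> G"
    and xy: "x \<noteq> 0" "y \<noteq> 0" "x \<noteq> y" "x \<cdot> y = e"
  shows "g (x + y) = g x + g y"
proof (rule ccontr)
  define D where "D x y = g x + g y + g (x + y)" for x y
  have D_sym: "D x y = D y x" for x y by (simp add: D_def ac_simps)
  have D_step: "D x y = D x z" if "indep3 x y z" "x \<cdot> y = e" "x \<cdot> z = e" for x y z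
  proof -
    \<comment> \<open>The pair \<open>y\<close>, \<open>x + y\<close> also has product
      \<open>e\<close>, and translation by \<open>y + z\<close> turns it into \<open>z\<close>,
      \<open>x + z\<close>.\<close>
    have "g y + g (x + y) = g (y + (y + z)) + g (x + y + (y + z))"
      using T g that unfolding translation_type_def
      by (elim allE[of _ y] allE[of _ "x + y"] allE[of _ "y + z"])
         (auto simp: indep3_def dot_add_left dot_add_right dot_commute[of y x] ac_simps)
    then show ?thesis by (simp add: D_def ac_simps)
  qed
  have D_const: "D x y = D x' y'"
    if "x \<noteq> 0" "y \<noteq> 0" "x \<noteq> y" "x \<cdot> y = e" "x' \<noteq> 0" "y' \<noteq> 0" "x' \<noteq> y'" "x' \<cdot> y' = e" for x y x' y'
  proof -
    have "independent {x, x'}" using that independent_pair[of x x'] by (cases "x = x'") (auto simp: independent_insert)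
    \<comment> \<open>A common partner \<open>z\<close> of \<open>x\<close> and \<open>x'\<close>
      links the two pairs through \<open>(x, z)\<close> and \<open>(x', z)\<close>.\<close>
    then obtain z where z: "z \<notin> span ({x, x'} \<union> {y, y'})" "\<And>a. a \<in> {x, x'} \<Longrightarrow> z \<cdot> a = e"
      using exists_point[of "{y, y'}" "{x, x'}" "\<lambda>_. e"] by auto
    have zn: "z \<notin> span {x, y, x}" "z \<notin> span {x', y', x'}" "z \<notin> span {x, x', x}"
      using z(1) span_mono[of "{x, y, x}" "{x, x'} \<union> {y, y'}"]
        span_mono[of "{x', y', x'}" "{x, x'} \<union> {y, y'}"]
        span_mono[of "{x, x', x}" "{x, x'} \<union> {y, y'}"] by auto
    have zx: "z \<cdot> x = e" "z \<cdot> x' = e" "x \<cdot> z = e" "x' \<cdot> z = e"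
      using z(2) dot_commute[of x z] dot_commute[of x' z] by auto
    have "D x y = D x z"
      by (rule D_step) (use zn(1) that zx in \<open>auto simp: not_in_span3 indep3_def eq_null ac_simps null_def[of 0]\<close>)
    also have "\<dots> = D z x" by (rule D_sym)
    also have "\<dots> = D z x'"
    proof (cases "x = x'")
      case False
      then show ?thesis
        by (intro D_step) (use zn(3) that zx in \<open>auto simp: not_in_span3 indep3_def eq_null ac_simps\<close>)
    qed simp
    also have "\<dots> = D x' z" by (rule D_sym)
    also have "\<dots> = D x' y'"
      by (rule D_step[symmetric]) (use zn(2) that zx in \<open>auto simp: not_in_span3 indep3_def eq_null ac_simps\<close>)
    finally show ?thesis .
  qed
  assume "g (x + y) \<noteq> g x + g y"
  then have "D x y \<noteq> 0" by (auto simp: D_def add_eq_0_iff_eq)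
  text \<open>The constant value of \<open>D\<close> is \<open>g u\<close> for some \<open>u\<close>, which contradicts injectivity.\<close>
  define u where "u = finv g (D x y)"
  have gu: "g u = D x y" using g by (simp add: u_def)
  have "u \<noteq> 0" using gu \<open>D x y \<noteq> 0\<close> fixes_zero[OF g] by auto
  then have "independent {u}" by (simp add: independent_insert)
  then obtain v where v: "v \<notin> span ({u} \<union> {})" "\<And>a. a \<in> {u} \<Longrightarrow> v \<cdot> a = e"
    using exists_point[of "{}" "{u}" "\<lambda>_. e"] by auto
  have "v \<noteq> 0" "u \<noteq> v" using v(1) span_zero span_base by auto
  moreover have "u \<cdot> v = e" using v(2)[of u] dot_commute[of u v] by simp
  ultimately have "D u v = g u" using D_const[of u v x y] xy gu \<open>u \<noteq> 0\<close> by simp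
  then have "g v = g (u + v)" by (simp add: D_def add.assoc add_eq_0_iff_eq)
  then show False using g \<open>u \<noteq> 0\<close> by simp
qed

text \<open>Additivity on pairs with product \<open>e\<close> makes a three-point set
  \<open>{v, a, v + a}\<close> nonspreadable, against the minimality of four points.\<close>

lemma no_minimal_nonspreadable_quadruple:
  assumes M: "minimal_nonspreadable {a, b, c, a + b + c}" and abc: "indep3 a b c"
  shows False
proof -
  have "quad_type (a \<cdot> b) (b \<cdot> c) (a \<cdot> c)"
    using quad_typeI[OF abc] bad_quadruple_add[OF M abc] by blast
  then obtain e where T: "translation_type e" using exists_translation_type by blast
  have a: "a \<noteq> 0" using abc by (auto simp: indep3_def)
  then have "independent {a}" by (simp add: independent_insert)
  then obtain v where v: "v \<notin> span ({a} \<union> {})" "\<And>x. x \<in> {a} \<Longrightarrow> v \<cdot> x = e"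
    using exists_point[of "{}" "{a}" "\<lambda>_. e"] by auto
  have va: "v \<noteq> 0" "v \<noteq> a" "v \<cdot> a = e" using v span_zero span_base by auto
  have "\<not> independent (g ` {v, a, v + a})" if "g \<in> G" for g
  proof
    assume "independent (g ` {v, a, v + a})"
    moreover have "g (v + a) = g v + g a"
      using translation_type_add[OF T that va(1) a va(2,3)] .
    ultimately have "g v + g a \<notin> span {g v, g a}"
      using that va a by (auto simp: insert_commute[of _ "g v + g a"] independent_insert split: if_splits)
    then show False by (auto intro: span_add span_base)
  qed
  then have "\<not> spreadable {v, a, v + a}" by (auto simp: spreadable_def)
  moreover have "card {v, a, v + a} < card {a, b, c, a + b + c}"
  proof -
    have "card {v, a, v + a} \<le> 3" by (simp add: card_insert_if)
    moreover have "card {a, b, c, a + b + c} = 4"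
    proof -
      have "a \<noteq> b" "a \<noteq> c" "b \<noteq> c" "a \<noteq> a + b + c" "b \<noteq> a + b + c" "c \<noteq> a + b + c"
        using abc by (simp_all add: indep3_def eq_null ac_simps)
      then show ?thesis by simp
    qed
    ultimately show ?thesis by simp
  qed
  moreover have "0 \<notin> {v, a, v + a}" using va a by (auto simp: add_eq_0_iff_eq)
  ultimately show False using M by (auto simp: minimal_nonspreadable_def)
qed

section \<open>Minimal nonspreadable sets of five or more points\<close>

text \<open>
  Replacing two members \<open>a\<close>, \<open>b\<close> of \<open>A\<close> by \<open>a + w\<close>, \<open>b + w\<close>, with \<open>w\<close> orthogonal to \<open>A\<close>, keeps the Gram matrix
  and the sum \<open>c\<close>. So \<open>g c\<close> has two expressions in terms of vectors that \<open>g\<close> can make independent.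
\<close>
lemma no_large_minimal_nonspreadable:
  assumes M: "minimal_nonspreadable (insert c A)" and cA: "c \<notin> A" and A: "independent A"
    and card: "4 \<le> card A"
  shows False
proof -
  have fin: "finite A" using M by (simp add: minimal_nonspreadable_def)
  have "A \<noteq> {}" using card by auto
  then obtain a where a: "a \<in> A" by blast
  have "A - {a} \<noteq> {}"
  proof
    assume "A - {a} = {}"
    then have "A = {a}" using a by blast
    then show False using card by simp
  qed
  then obtain b where b: "b \<in> A" "b \<noteq> a" by blast
  define A0 where "A0 = A - {a, b}"
  have A_eq: "A = insert a (insert b A0)" "a \<notin> insert b A0" "b \<notin> A0" "finite A0"
    using a b fin by (auto simp: A0_def)
  obtain w where w: "w \<notin> span A" "\<And>e. e \<in> A \<Longrightarrow> w \<cdot> e = 0"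
    using exists_point_independent[OF fin A, of "\<lambda>_. 0"] by blast
  have c: "c = a + (b + \<Sum>A0)"
    using minimal_nonspreadable_eq_sum[OF M cA A] A_eq by simp
  define E where "E = {a, b, a + w, b + w}"
  have ABspan: "a \<in> span A" "b \<in> span A" using a b span_base by auto
  have w_add: "w \<notin> span A" "x + w \<notin> span A" if "x \<in> span A" for x
    using w(1) span_add_eq[OF that, of w] by auto
  have E_ne: "a \<noteq> b" "a \<noteq> a + w" "a \<noteq> b + w" "b \<noteq> a + w" "b \<noteq> b + w" "a + w \<noteq> b + w"
    using b(2) w_add[OF ABspan(1)] w_add[OF ABspan(2)] ABspan span_zero by (auto simp: span_zero)
  have "0 \<notin> A" using M A dependent_zero by blast
  \<comment> \<open>\<open>E\<close> has at most four points, fewer than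
    \<open>insert c A\<close>.\<close>
  have "spreadable E"
  proof -
    have "card E \<le> 4" unfolding E_def by (simp add: card_insert_if)
    moreover have "card (insert c A) = Suc (card A)" using cA fin by simp
    moreover have "0 \<notin> E"
      using \<open>0 \<notin> A\<close> a b(1) w_add(2)[OF ABspan(1)] w_add(2)[OF ABspan(2)] span_zero[of A]
      unfolding E_def by force
    moreover have "finite E" by (simp add: E_def)
    ultimately show ?thesis using M card by (auto simp: minimal_nonspreadable_def)
  qed
  then obtain h where h: "h \<in> G" "independent (h ` E)" by (auto simp: spreadable_def)
  have "e \<notin> span (E \<union> (A0 - {e}))" if "e \<in> A0" for e
  proof -
    have e: "e \<in> A" "a \<in> A - {e}" "b \<in> A - {e}" using that A_eq by auto
    have "E \<union> (A0 - {e}) \<subseteq> span (insert w (A - {e}))"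
      using e(2,3) unfolding E_def A0_def by (auto intro!: span_add intro: span_base)
    then have "span (E \<union> (A0 - {e})) \<subseteq> span (insert w (A - {e}))" by (intro span_minimal) auto
    moreover have "e \<notin> span (insert w (A - {e}))"
    proof
      assume "e \<in> span (insert w (A - {e}))"
      then have "w \<in> span (insert e (A - {e}))"
        using in_span_insert not_in_span_remove[OF A e(1)] by blast
      then show False using w(1) e(1) by (simp add: insert_absorb)
    qed
    ultimately show ?thesis by blast
  qed
  then obtain g where g: "g \<in> G" "independent (g ` (E \<union> A0))"
    using extend_spread_many[of A0 E h] h A_eq(4) by (auto simp: E_def)
  \<comment> \<open>The replacement takes two moves: \<open>s1\<close> takes \<open>a\<close> to
    \<open>a + w\<close> fixing the rest of \<open>A\<close>, then \<open>s2\<close> takes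
    \<open>b\<close> to \<open>b + w\<close> fixing \<open>a + w\<close> and
    \<open>A0\<close>.\<close>
  obtain s1 where s1: "s1 \<in> Sp scale P" "\<And>x. x \<in> span (A - {a}) \<Longrightarrow> s1 x = x" "s1 a = a + w"
  proof -
    have "span (A - {a}) \<subseteq> span A" by (rule span_mono) blast
    then have "a + w \<notin> span (A - {a})" using w_add(2)[OF ABspan(1)] by blast
    then show ?thesis
      using Sp_transport[of "A - {a}" a "a + w"] fin not_in_span_remove[OF A a] w(2) that
      by (auto simp: dot_add_left)
  qed
  obtain s2 where s2: "s2 \<in> Sp scale P" "\<And>x. x \<in> span (insert (a + w) A0) \<Longrightarrow> s2 x = x" "s2 b = b + w"
  proof -
    have sub: "span A0 \<subseteq> span A" "span A0 \<subseteq> span (A - {b})" "span (insert b A0) \<subseteq> span A"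
      using A_eq by (auto intro!: span_mono)
    have b0: "b \<notin> span A0" using not_in_span_remove[OF A b(1)] sub(2) by blast
    have "b \<notin> span (insert (a + w) A0)"
      using in_span_insert[of b "a + w" A0] b0 sub(3) w_add(2)[OF ABspan(1)] by blast
    moreover have "b + w \<notin> span (insert (a + w) A0)"
    proof
      assume "b + w \<in> span (insert (a + w) A0)"
      moreover have "b + w \<notin> span A0" using sub(1) w_add(2)[OF ABspan(2)] by blast
      ultimately obtain z where z: "z \<in> span A0" "b + w = a + w + z"
        by (auto simp: span_insert_bit)
      then have "b = a + z" by (simp add: ac_simps)
      moreover have "a \<in> span (A - {b})" "z \<in> span (A - {b})"
        using a b(2) z(1) sub(2) by (auto intro: span_base)
      ultimately show False using not_in_span_remove[OF A b(1)] span_add by blast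
    qed
    moreover have "b \<cdot> e = (b + w) \<cdot> e" if "e \<in> insert (a + w) A0" for e
      using that w(2) a b A_eq dot_commute[of b w] by (auto simp: dot_add_left dot_add_right)
    ultimately show ?thesis
      using Sp_transport[of "insert (a + w) A0" b "b + w"] A_eq(4) that by auto
  qed
  define s where "s = s2 \<circ> s1"
  have gs: "g \<circ> s \<in> G"
    unfolding s_def by (intro comp g(1) Sp_in s1(1) s2(1))
  have s_a: "s a = a + w" using s1(3) s2(2)[of "a + w"] by (simp add: s_def span_base)
  have s_b: "s b = b + w" using s1(2)[of b] s2(3) b by (simp add: s_def span_base)
  have s_0: "s e = e" if "e \<in> A0" for e
    using s1(2)[of e] s2(2)[of e] that A_eq by (auto simp: s_def span_base)
  have s_add: "s (x + y) = s x + s y" for x y using s1(1) s2(1) by (simp add: s_def Sp_iff)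
  have "s (\<Sum>A0) = \<Sum>A0" using additive_sum[of s "\<lambda>x. x" A0, OF s_add] s_0 by simp
  then have s_c: "s c = c" unfolding c by (simp add: s_add s_a s_b ac_simps)
  have "g c = (\<Sum>x\<in>A. g x)"
  proof (rule minimal_nonspreadable_image_eq_sum[OF M cA g(1)])
    have "A \<subseteq> E \<union> A0" using A_eq(1) by (auto simp: E_def)
    then show "independent (g ` A)" using independent_mono[OF g(2)] by blast
  qed
  then have 1: "g c = g a + (g b + (\<Sum>x\<in>A0. g x))" using A_eq by simp
  have "(g \<circ> s) c = (\<Sum>x\<in>A. (g \<circ> s) x)"
  proof (rule minimal_nonspreadable_image_eq_sum[OF M cA gs])
    have "(g \<circ> s) ` A \<subseteq> g ` (E \<union> A0)" using s_a s_b s_0 A_eq(1) by (auto simp: E_def)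
    then show "independent ((g \<circ> s) ` A)" using independent_mono[OF g(2)] by blast
  qed
  then have "g c = g (a + w) + (g (b + w) + (\<Sum>x\<in>A0. g x))"
    using A_eq s_0 by (simp add: s_a s_b s_c)
  \<comment> \<open>The terms from \<open>A0\<close> cancel, leaving a linear relation between the
    independent images of the four points of \<open>E\<close>.\<close>
  with 1 have sum: "g a = g b + (g (a + w) + g (b + w))"
    by (simp add: add_eq_iff_eq_add ac_simps)
  have "g ` {b, a + w, b + w} \<subseteq> g ` (E \<union> A0) - {g a}"
    using E_ne g(1) by (auto simp: E_def)
  then have "span (g ` {b, a + w, b + w}) \<subseteq> span (g ` (E \<union> A0) - {g a})" by (rule span_mono)
  moreover have "g a \<in> span (g ` {b, a + w, b + w})"
    unfolding sum by (auto intro!: span_add intro: span_base)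
  moreover have "g a \<in> g ` (E \<union> A0)" by (simp add: E_def)
  ultimately show False using not_in_span_remove[OF g(2)] by blast
qed

lemma all_spreadable:
  assumes nonlin: "g0 \<in> G" "g0 (x0 + y0) \<noteq> g0 x0 + g0 y0"
    and S: "finite S" "0 \<notin> S"
  shows "spreadable S"
proof (rule ccontr)
  assume "\<not> spreadable S"
  then have "\<exists>B. finite B \<and> 0 \<notin> B \<and> \<not> spreadable B" using S by blast
  from ex_has_least_nat[of "\<lambda>B. finite B \<and> 0 \<notin> B \<and> \<not> spreadable B", of _ card] this
  obtain B where "finite B \<and> 0 \<notin> B \<and> \<not> spreadable B"
    "\<And>C. finite C \<and> 0 \<notin> C \<and> \<not> spreadable C \<Longrightarrow> card B \<le> card C" by metis
  then have "minimal_nonspreadable B" unfolding minimal_nonspreadable_def by force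
  then obtain c A where *: "minimal_nonspreadable (insert c A)" "c \<notin> A" "independent A" "c = \<Sum>A"
    "2 \<le> card A" by (rule minimal_nonspreadable_normal_form) blast
  consider "card A = 2" | "card A = 3" | "4 \<le> card A" using *(5) by linarith
  then show False
  proof cases
    case 1
    then obtain x y where xy: "A = {x, y}" "x \<noteq> y" by (auto simp: card_2_iff)
    have "0 \<notin> A" using *(1) by (simp add: minimal_nonspreadable_def)
    then have "bad_line x y" using *(1,4) xy by (auto simp: bad_line_def insert_commute)
    then show False using bad_line_additive nonlin by blast
  next
    case 2
    then obtain x y z where xyz: "A = {x, y, z}" "x \<noteq> y" "y \<noteq> z" "x \<noteq> z"
      by (auto simp: card_3_iff)
    then have "c = x + y + z" using *(4) by (simp add: ac_simps)
    then have "minimal_nonspreadable {x, y, z, x + y + z}"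
      using *(1) xyz(1) by (simp add: insert_commute)
    moreover have "indep3 x y z" using *(3) 2 xyz(1) by (simp add: indep3_iff)
    ultimately show False by (rule no_minimal_nonspreadable_quadruple)
  next
    case 3
    then show False using no_large_minimal_nonspreadable * by blast
  qed
qed

section \<open>High transitivity by counting orbits\<close>

definition stabilizer_transitive :: "'v set \<Rightarrow> bool" where
  "stabilizer_transitive A \<longleftrightarrow> (\<forall>x y. x \<notin> insert 0 A \<longrightarrow> y \<notin> insert 0 A \<longrightarrow> same_orbit A x y)"

text \<open>Only stabilizers of fewer than \<open>n\<close> points are used, so a smallest failure
  of transitivity, at \<open>k\<close> points, still allows \<open>k\<close>-point sets to be moved
  freely.\<close>

lemma tuple_transitive:
  assumes hom: "\<And>A. finite A \<Longrightarrow> 0 \<notin> A \<Longrightarrow> card A < n \<Longrightarrow> stabilizer_transitive A"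
    and S: "finite S" "0 \<notin> S" "card S \<le> n" and f: "inj_on f S" "0 \<notin> f ` S"
  shows "\<exists>g\<in>G. \<forall>x\<in>S. g x = f x"
  using S f
proof (induction S rule: finite_induct)
  case empty
  then show ?case using Sp_in[OF id_in_Sp] by blast
next
  case (insert x S)
  then obtain g where g: "g \<in> G" "\<And>a. a \<in> S \<Longrightarrow> g a = f a" by auto
  have im: "g ` S = f ` S" using g(2) by (rule image_cong[OF refl])
  have "stabilizer_transitive (g ` S)"
  proof (rule hom)
    show "finite (g ` S)" "0 \<notin> g ` S" using insert.hyps insert.prems im by auto
    show "card (g ` S) < n"
      using insert.hyps insert.prems card_image_le[OF insert.hyps(1), of g] by simp
  qed
  moreover have "g x \<notin> insert 0 (g ` S)"
    using insert.hyps(2) insert.prems g(1) by (auto simp: eq_zero_iff)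
  moreover have "f x \<notin> insert 0 (g ` S)"
    using insert.hyps insert.prems unfolding im by (auto simp: inj_on_def)
  ultimately have "same_orbit (g ` S) (g x) (f x)" by (simp add: stabilizer_transitive_def)
  then obtain h where "h \<in> G" "\<And>a. a \<in> S \<Longrightarrow> h (g a) = g a" "h (g x) = f x"
    by (auto simp: same_orbit_def)
  then show ?case using comp[of h g] g by (intro bexI[of _ "h \<circ> g"]) auto
qed

text \<open>
  If two inequivalent points can be found over each independent \<open>k\<close>-set, the choices for \<open>m\<close> disjoint
  such sets can be combined, because a point may have arbitrary products with an independent set.
\<close>
lemma many_orbits:
  assumes two: "\<And>A. finite A \<Longrightarrow> independent A \<Longrightarrow> card A = k \<Longrightarrow>
      \<exists>x y. x \<notin> span A \<and> y \<notin> span A \<and> \<not> same_orbit A x y"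
    and P: "finite Q" "independent Q" "card Q = m * k"
  shows "\<exists>X. finite X \<and> card X = 2 ^ m \<and> X \<inter> span Q = {} \<and>
    (\<forall>x\<in>X. \<forall>y\<in>X. same_orbit Q x y \<longrightarrow> x = y)"
  using P
proof (induction m arbitrary: Q)
  case 0
  then obtain x where "x \<notin> span Q"
    using exists_point_independent[of Q "\<lambda>_. 0"] by blast
  then show ?case by (intro exI[of _ "{x}"]) simp
next
  case (Suc m)
  obtain A where A: "A \<subseteq> Q" "card A = k" "finite A"
    using obtain_subset_with_card_n[of k Q] Suc.prems by auto
  define Q' where "Q' = Q - A"
  have Q': "finite Q'" "independent Q'" "card Q' = m * k" "Q' \<subseteq> Q" "A \<inter> Q' = {}"
    using Suc.prems A independent_mono[OF Suc.prems(2)] by (auto simp: Q'_def card_Diff_subset)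
  obtain X where X: "finite X" "card X = 2 ^ m" "X \<inter> span Q' = {}"
    "\<And>x y. x \<in> X \<Longrightarrow> y \<in> X \<Longrightarrow> same_orbit Q' x y \<Longrightarrow> x = y"
    using Suc.IH[OF Q'(1-3)] by blast
  obtain y1 y2 where y: "y1 \<notin> span A" "y2 \<notin> span A" "\<not> same_orbit A y1 y2"
    using two[OF A(3) independent_mono[OF Suc.prems(2) A(1)] A(2)] by blast
  define z where
    "z x y = (SOME z. z \<notin> span Q \<and> (\<forall>a\<in>Q. z \<cdot> a = (if a \<in> A then y \<cdot> a else x \<cdot> a)))" for x y
  have "z x y \<notin> span Q \<and> (\<forall>a\<in>Q. z x y \<cdot> a = (if a \<in> A then y \<cdot> a else x \<cdot> a))" for x y
    unfolding z_def by (rule someI_ex) (rule exists_point_independent[OF Suc.prems(1,2)])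
  then have z: "z x y \<notin> span Q"
    "a \<in> Q \<Longrightarrow> z x y \<cdot> a = (if a \<in> A then y \<cdot> a else x \<cdot> a)" for x y a by blast+
  have zX: "same_orbit Q' (z x y) x" if "x \<in> X" for x y
  proof (rule same_orbit_mono[OF same_orbit_dots])
    show "z x y \<notin> span Q'" using z(1) span_mono[OF Q'(4)] by blast
    show "x \<notin> span Q'" using that X(3) by blast
    show "z x y \<cdot> a = x \<cdot> a" if "a \<in> Q'" for a using that by (simp add: z(2) Q'_def)
  qed (use Q' in \<open>auto simp: span_base\<close>)
  have zY: "same_orbit A (z x y) y" if "y \<in> {y1, y2}" for x y
  proof (rule same_orbit_mono[OF same_orbit_dots])
    show "z x y \<notin> span A" using z(1) span_mono[OF A(1)] by blast
    show "y \<notin> span A" using that y by blast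
    show "z x y \<cdot> a = y \<cdot> a" if "a \<in> A" for a using that z(2)[of a] A(1) by (simp add: subsetD)
  qed (use A in \<open>auto simp: span_base\<close>)
  \<comment> \<open>\<open>z x y\<close> is equivalent to \<open>x\<close> over \<open>Q'\<close>
    and to \<open>y\<close> over \<open>A\<close>, so its orbit over \<open>Q\<close> determines
    both choices.\<close>
  have key: "x = x' \<and> y = y'"
    if "x \<in> X" "x' \<in> X" "y \<in> {y1, y2}" "y' \<in> {y1, y2}" "same_orbit Q (z x y) (z x' y')" for x x' y y'
  proof
    have "same_orbit Q' x x'"
      using that zX same_orbit_mono[OF _ Q'(4)] same_orbit_sym same_orbit_trans by meson
    then show "x = x'" using X(4) that by blast
    have "same_orbit A y y'"
      using that zY same_orbit_mono[OF _ A(1)] same_orbit_sym same_orbit_trans by meson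
    then show "y = y'" using that(3,4) y(3) same_orbit_sym by blast
  qed
  define f where "f = (\<lambda>(x, y). z x y)"
  have "y1 \<noteq> y2" using y(3) same_orbit_refl by blast
  have "inj_on f (X \<times> {y1, y2})"
  proof (rule inj_onI)
    fix u v assume uv: "u \<in> X \<times> {y1, y2}" "v \<in> X \<times> {y1, y2}" "f u = f v"
    have "same_orbit Q (z (fst u) (snd u)) (z (fst v) (snd v))"
      using uv(3) same_orbit_refl[of Q "f v"] by (simp add: f_def split_beta)
    then show "u = v"
      using key[of "fst u" "fst v" "snd u" "snd v"] uv(1,2) by (simp add: mem_Times_iff prod_eq_iff)
  qed
  then have "card (f ` (X \<times> {y1, y2})) = 2 ^ Suc m"
    using X(1,2) \<open>y1 \<noteq> y2\<close> by (simp add: card_image card_cartesian_product)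
  moreover have "finite (f ` (X \<times> {y1, y2}))" using X(1) by simp
  moreover have "f ` (X \<times> {y1, y2}) \<inter> span Q = {}" using z(1) by (auto simp: f_def)
  moreover have "\<forall>u\<in>f ` (X \<times> {y1, y2}). \<forall>v\<in>f ` (X \<times> {y1, y2}). same_orbit Q u v \<longrightarrow> u = v"
  proof (intro ballI impI)
    fix u v assume "u \<in> f ` (X \<times> {y1, y2})" "v \<in> f ` (X \<times> {y1, y2})" and uv: "same_orbit Q u v"
    then obtain x y x' y' where "x \<in> X" "y \<in> {y1, y2}" "x' \<in> X" "y' \<in> {y1, y2}"
      and eq: "u = z x y" "v = z x' y'" by (auto simp: f_def)
    then show "u = v" using key uv by blast
  qed
  ultimately show ?case by blast
qed

lemma exists_independent_card: "\<exists>E. finite E \<and> independent E \<and> card E = n"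
proof (induction n)
  case 0
  show ?case by (intro exI[of _ "{}"]) (simp add: independent_empty)
next
  case (Suc n)
  then obtain E where E: "finite E" "independent E" "card E = n" by blast
  obtain x where x: "x \<notin> span E" using exists_point_independent[OF E(1,2), of "\<lambda>_. 0"] by blast
  then have "x \<notin> E" using span_base by blast
  then show ?case using E x by (intro exI[of _ "insert x E"]) (simp add: independent_insertI)
qed

text \<open>Makes room for \<open>r + 2\<close> blocks of size \<open>k\<close> among the
  \<open>2^r - 1\<close> nonzero vectors of an \<open>r\<close>-dimensional space.\<close>

lemma exponential_bound: "\<exists>r::nat. (r + 2) * k < 2 ^ r"
proof
  define n where "n = 2 * k + 2"
  have n: "n + 1 \<le> 2 ^ n" by (simp add: Suc_le_eq less_exp)
  have "(2 * n + 2) * k = (n + 1) * (2 * k)" by (simp add: algebra_simps)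
  also have "\<dots> < (n + 1) * (n + 1)" by (intro mult_strict_left_mono) (simp_all add: n_def)
  also have "\<dots> \<le> 2 ^ n * 2 ^ n" using n by (intro mult_le_mono)
  also have "\<dots> = 2 ^ (2 * n)" by (simp add: mult_2 power_add)
  finally show "(2 * n + 2) * k < 2 ^ (2 * n)" .
qed

text \<open>A smallest counterexample \<open>B\<close> has two inequivalent further points.
  Spreading them with \<open>B\<close> and moving \<open>B\<close> by
  \<open>tuple_transitive\<close> gives two orbits off the span of every independent
  \<open>k\<close>-set, as \<open>many_orbits\<close> requires.\<close>

lemma all_stabilizers_transitive:
  assumes spread: "\<And>S. finite S \<Longrightarrow> 0 \<notin> S \<Longrightarrow> spreadable S"
    and A: "finite A" "0 \<notin> A"
  shows "stabilizer_transitive A"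
proof (rule ccontr)
  assume "\<not> stabilizer_transitive A"
  then have "\<exists>B. finite B \<and> 0 \<notin> B \<and> \<not> stabilizer_transitive B" using A by blast
  from ex_has_least_nat[of "\<lambda>B. finite B \<and> 0 \<notin> B \<and> \<not> stabilizer_transitive B", of _ card] this
  obtain B where B: "finite B" "0 \<notin> B" "\<not> stabilizer_transitive B"
    and min: "\<And>C. finite C \<and> 0 \<notin> C \<and> \<not> stabilizer_transitive C \<Longrightarrow> card B \<le> card C" by metis
  define k where "k = card B"
  have hom: "stabilizer_transitive C" if "finite C" "0 \<notin> C" "card C < k" for C
    using min[of C] that by (auto simp: k_def)
  obtain x y where xy: "x \<notin> insert 0 B" "y \<notin> insert 0 B" "\<not> same_orbit B x y"
    using B(3) by (auto simp: stabilizer_transitive_def)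
  then have "x \<noteq> y" using same_orbit_refl by blast
  have "spreadable (insert x (insert y B))" using xy B by (intro spread) auto
  then obtain g where g: "g \<in> G" "independent (g ` insert x (insert y B))"
    by (auto simp: spreadable_def)
  have gn: "g x \<notin> insert (g y) (g ` B)" "g y \<notin> g ` B" using xy \<open>x \<noteq> y\<close> g(1) by auto
  have notspan: "g x \<notin> span (g ` B)" "g y \<notin> span (g ` B)"
    using g(2) gn span_mono[of "g ` B" "insert (g y) (g ` B)"] by (auto simp: independent_insert)
  have orbit: "\<not> same_orbit (g ` B) (g x) (g y)"
  proof
    assume "same_orbit (g ` B) (g x) (g y)"
    from same_orbit_image[OF this inv[OF g(1)]] show False
      using xy(3) g(1) by (simp add: image_image)
  qed
  have two: "\<exists>x y. x \<notin> span C \<and> y \<notin> span C \<and> \<not> same_orbit C x y"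
    if C: "finite C" "independent C" "card C = k" for C
  proof -
    have "card (g ` B) = k"
      using inj[OF g(1)] by (simp add: k_def card_image inj_on_subset[of _ UNIV])
    then obtain f where f: "bij_betw f (g ` B) C"
      using finite_same_card_bij[of "g ` B" C] B(1) C by auto
    have "0 \<notin> C" using C(2) dependent_zero by blast
    moreover have "0 \<notin> g ` B" using B(2) g(1) by (auto simp: eq_zero_iff)
    ultimately have "\<exists>h\<in>G. \<forall>v\<in>g ` B. h v = f v"
      using hom B(1) \<open>card (g ` B) = k\<close> f
      by (intro tuple_transitive[of k]) (auto simp: bij_betw_def)
    then obtain h where h: "h \<in> G" "\<And>v. v \<in> g ` B \<Longrightarrow> h v = f v" by blast
    have "h ` g ` B = f ` g ` B" using h(2) by (rule image_cong[OF refl])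
    then have hB: "h ` g ` B = C" using f by (simp add: bij_betw_def)
    \<comment> \<open>\<open>h\<close> need not be linear, so \<open>h u\<close> may fall into
      \<open>span C\<close>; \<open>u\<close> is first replaced by an equivalent point whose image
      does not.\<close>
    have "\<exists>v. v \<notin> span C \<and> same_orbit C (h u) v" if u: "u \<notin> span (g ` B)" for u
    proof -
      define F where "F = finv h ` span C"
      have "finite F" using C(1) by (simp add: F_def finite_span)
      then obtain v where v: "v \<notin> span (insert u (g ` B \<union> F))" "\<And>a. a \<in> span (g ` B) \<Longrightarrow> v \<cdot> a = u \<cdot> a"
        using exists_point_like[of F "g ` B" u] B(1) by blast
      have "v \<notin> span (g ` B)" using v(1) span_mono[of "g ` B" "insert u (g ` B \<union> F)"] by blast
      then have "same_orbit (span (g ` B)) u v"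
        using v(2) u B(1) by (intro same_orbit_dots) (auto simp: span_base)
      then have "same_orbit (g ` B) u v" by (rule same_orbit_mono) (rule span_superset)
      then have "same_orbit C (h u) (h v)" using same_orbit_image[OF _ h(1)] hB by metis
      moreover have "h v \<notin> span C"
      proof
        assume "h v \<in> span C"
        then have "finv h (h v) \<in> F" unfolding F_def by (rule imageI)
        then show False using v(1) h(1) span_base[of v "insert u (g ` B \<union> F)"] by simp
      qed
      ultimately show ?thesis by blast
    qed
    then obtain v1 v2 where v: "v1 \<notin> span C" "same_orbit C (h (g x)) v1"
      "v2 \<notin> span C" "same_orbit C (h (g y)) v2" using notspan by meson
    have "\<not> same_orbit C v1 v2"
    proof
      assume "same_orbit C v1 v2"
      then have "same_orbit C (h (g x)) (h (g y))"
        using v same_orbit_sym same_orbit_trans by meson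
      from same_orbit_image[OF this inv[OF h(1)]]
      have "same_orbit (g ` B) (g x) (g y)"
        unfolding hB[symmetric] using h(1) by (simp add: image_image)
      then show False using orbit by blast
    qed
    then show ?thesis using v by blast
  qed
  obtain r :: nat where r: "(r + 2) * k < 2 ^ r" using exponential_bound by blast
  obtain E where E: "finite E" "independent E" "card E = r" using exists_independent_card by blast
  define U where "U = span E"
  have U: "finite U" "card U = 2 ^ r" using E by (simp_all add: U_def finite_span card_span_independent)
  have "spreadable (U - {0})" using U by (intro spread) auto
  then obtain h where h: "h \<in> G" "independent (h ` (U - {0}))" by (auto simp: spreadable_def)
  have "card (h ` (U - {0})) = card (U - {0})"
    using inj[OF h(1)] by (intro card_image) (rule inj_on_subset, auto)
  also have "\<dots> = 2 ^ r - 1" using U by (simp add: U_def span_zero)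
  finally have "(r + 2) * k \<le> card (h ` (U - {0}))" using r by simp
  then obtain Q where Q: "Q \<subseteq> h ` (U - {0})" "card Q = (r + 2) * k" "finite Q"
    by (rule obtain_subset_with_card_n)
  obtain X where X: "finite X" "card X = 2 ^ (r + 2)"
    "\<And>x y. x \<in> X \<Longrightarrow> y \<in> X \<Longrightarrow> same_orbit Q x y \<Longrightarrow> x = y"
    using many_orbits[of k Q "r + 2"] two Q(2,3) independent_mono[OF h(2) Q(1)] by blast
  text \<open>The points of \<open>finv h ` X\<close> lie in different orbits of the stabilizer of \<open>U\<close>, but
    a point is determined up to that stabilizer by its products with \<open>E\<close>, unless it lies in \<open>U\<close>.\<close>
  define \<tau> where "\<tau> v = (if v \<in> U then Inl v else Inr {e \<in> E. v \<cdot> e = 1})" for v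
  have "inj_on (\<lambda>x. \<tau> (finv h x)) X"
  proof (rule inj_onI)
    fix x y assume xy: "x \<in> X" "y \<in> X" "\<tau> (finv h x) = \<tau> (finv h y)"
    have "same_orbit U (finv h x) (finv h y)"
    proof (cases "finv h x \<in> U")
      case True
      then have "finv h x = finv h y" using xy(3) by (auto simp: \<tau>_def split: if_splits)
      then show ?thesis by (simp add: same_orbit_refl)
    next
      case False
      then have n: "finv h x \<notin> U" "finv h y \<notin> U"
        and eq: "{e \<in> E. finv h x \<cdot> e = 1} = {e \<in> E. finv h y \<cdot> e = 1}"
        using xy(3) by (auto simp: \<tau>_def split: if_splits)
      have "finv h x \<cdot> e = finv h y \<cdot> e" if "e \<in> E" for e
      proof -
        have "finv h x \<cdot> e = 1 \<longleftrightarrow> finv h y \<cdot> e = 1" using eq that by blast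
        then show ?thesis by (metis bit_not_one_iff)
      qed
      then show ?thesis using n E(1) unfolding U_def by (intro same_orbit_dots)
    qed
    from same_orbit_image[OF this h(1)] have "same_orbit (h ` U) x y" using h(1) by simp
    moreover have "Q \<subseteq> h ` U" using Q(1) by blast
    ultimately show "x = y" using X(3) xy same_orbit_mono by blast
  qed
  then have "card X \<le> card (U <+> Pow E)"
    using U(1) E(1) by (intro card_inj_on_le[of "\<lambda>x. \<tau> (finv h x)"]) (auto simp: \<tau>_def)
  \<comment> \<open>At most \<open>2^r\<close> orbits inside \<open>U\<close> and \<open>2^r\<close>
    product patterns outside: half of the \<open>2^(r+2)\<close> points of \<open>X\<close>.\<close>
  also have "\<dots> = 2 ^ r + 2 ^ r" using U E by (simp add: card_Plus card_Pow)
  finally show False using X(2) by simp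
qed

lemma Sym0_subset:
  assumes nonlin: "g0 \<in> G" "g0 (x0 + y0) \<noteq> g0 x0 + g0 y0"
  shows "Sym0 \<subseteq> G"
proof
  fix \<pi> :: "'v \<Rightarrow> 'v" assume "\<pi> \<in> Sym0"
  then have \<pi>: "bij \<pi>" "\<pi> 0 = 0" by (simp_all add: Sym0_def carrier_Sym)
  have hom: "stabilizer_transitive A" if "finite A" "0 \<notin> A" for A
    using that all_spreadable[OF nonlin] by (intro all_stabilizers_transitive)
  show "\<pi> \<in> G"
  proof (rule closed[OF \<pi>(1)])
    fix S :: "'v set" assume S: "finite S"
    have "\<pi> x \<noteq> 0" if "x \<noteq> 0" for x using that \<pi> by (metis bij_is_inj injD)
    then have "\<exists>g\<in>G. \<forall>x\<in>S - {0}. g x = \<pi> x"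
      using S hom \<pi>(1) by (intro tuple_transitive[of "card (S - {0})"])
        (force intro: inj_on_subset[OF bij_is_inj])+
    then obtain g where "g \<in> G" "\<forall>x\<in>S - {0}. g x = \<pi> x" by blast
    then have "\<forall>x\<in>S. g x = \<pi> x" using \<pi>(2) fixes_zero by (metis Diff_iff singletonD)
    then show "\<exists>\<sigma>\<in>G. \<forall>x\<in>S. \<sigma> x = \<pi> x" using \<open>g \<in> G\<close> by blast
  qed
qed

end

subsection \<open>The six groups\<close>

context fraisse_limit
begin

lemma GL_iff: "g \<in> GL scale \<longleftrightarrow> bij g \<and> (\<forall>x y. g (x + y) = g x + g y)"
  by (simp add: GL_def carrier_Sym linear_iff_additive)

lemma GL_zero: "g \<in> GL scale \<Longrightarrow> g 0 = 0"
  using additive_zero[of g] by (simp add: GL_iff)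

lemma mult_Sym: "bij g \<Longrightarrow> bij h \<Longrightarrow> g \<otimes>\<^bsub>Sym\<^esub> h = g \<circ> h"
  by (simp add: Sym_def BijGroup_def Bij_def compose_def restrict_UNIV comp_def)

lemma inv_Sym: "bij g \<Longrightarrow> inv\<^bsub>Sym\<^esub> g = finv g"
  using inv_BijGroup[of g UNIV] by (simp add: Sym_def Bij_def restrict_UNIV)

lemma one_Sym: "\<one>\<^bsub>Sym\<^esub> = id"
  by (simp add: Sym_def BijGroup_def restrict_UNIV id_def)

lemma group_Sym: "group Sym"
  by (simp add: Sym_def group_BijGroup)

lemma bij_translation: "bij (\<lambda>x. x + a :: 'v)"
  by (rule involuntory_imp_bij) (simp add: add.assoc)

text \<open>The affine identity survives composition and inversion; conversely, following
  \<open>g\<close> by the translation by \<open>g 0\<close> gives a linear map.\<close>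

lemma AGL_iff: "g \<in> AGL scale \<longleftrightarrow> bij g \<and> (\<forall>x y. g (x + y) = g x + g y + g 0)"
proof
  assume "g \<in> AGL scale"
  then have "g \<in> generate Sym (GL scale \<union> range (\<lambda>a v. v + a))" by (simp add: AGL_def)
  then show "bij g \<and> (\<forall>x y. g (x + y) = g x + g y + g 0)"
  proof (induction rule: generate.induct)
    case one
    then show ?case by (simp add: one_Sym bij_id[unfolded id_def])
  next
    case (incl g)
    then show ?case by (auto simp: GL_iff GL_zero bij_translation ac_simps)
  next
    case (inv g)
    then have g: "bij g" "\<And>x y. g (x + y) = g x + g y + g 0"
      by (auto simp: GL_iff GL_zero bij_translation ac_simps)
    have "finv g (x + y) = finv g x + finv g y + finv g 0" for x y
    proof -
      have "g (finv g x + finv g y + finv g 0) = x + y"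
        by (simp add: g bij_is_surj surj_f_inv_f ac_simps)
      then show ?thesis using g(1) by (metis bij_is_inj inv_f_f)
    qed
    then show ?case using g(1) by (simp add: inv_Sym bij_imp_bij_inv)
  next
    case (eng g h)
    then have "g (h x + h y + h 0) = g (h x) + g (h y) + g (h 0)" for x y
      by (simp add: ac_simps)
    then show ?case using eng bij_comp[of h g] by (auto simp: mult_Sym comp_def)
  qed
next
  assume g: "bij g \<and> (\<forall>x y. g (x + y) = g x + g y + g 0)"
  define h where "h = (\<lambda>x. x + g 0) \<circ> g"
  have "bij h" unfolding h_def using g bij_translation by (intro bij_comp) auto
  then have "h \<in> GL scale" using g by (auto simp: GL_iff h_def ac_simps)
  then have "(\<lambda>x. x + g 0) \<otimes>\<^bsub>Sym\<^esub> h \<in> AGL scale"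
    unfolding AGL_def by (intro generate.eng generate.incl) auto
  moreover have "(\<lambda>x. x + g 0) \<otimes>\<^bsub>Sym\<^esub> h = g"
    using \<open>bij h\<close> by (auto simp: mult_Sym bij_translation h_def add.assoc)
  ultimately show "g \<in> AGL scale" by simp
qed

lemma triangledown_translate: "triangledown P (x + a) (y + a) (z + a) = triangledown P x y z"
  by (simp add: triangledown_def dot_add_left dot_add_right dot_commute[of a] ac_simps)

text \<open>\<open>triangledown\<close> is invariant under translations, and on triples containing 0
  it is the relation \<open>x \<cdot> y = 1\<close>. So \<open>Delta\<close> consists of the
  symplectic maps followed by translations.\<close>

lemma Delta_iff: "g \<in> Delta P \<longleftrightarrow> (\<lambda>x. g x + g 0) \<in> Sp scale P"
proof
  assume "g \<in> Delta P"
  then have g: "bij g" "\<And>a b c. triangledown P (g a) (g b) (g c) = triangledown P a b c"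
    by (auto simp: Delta_def carrier_Sym)
  define h where "h x = g x + g 0" for x
  have h: "bij h" using bij_comp[OF g(1) bij_translation[of "g 0"]] by (simp add: h_def[abs_def] comp_def)
  have h0: "h 0 = 0" by (simp add: h_def)
  have tri: "triangledown P (h a) (h b) (h c) = triangledown P a b c" for a b c
    by (simp add: h_def triangledown_translate g)
  have "h x \<cdot> h y = x \<cdot> y" for x y
  proof (cases "x = 0 \<or> y = 0 \<or> x = y")
    case True
    then show ?thesis using h0 by auto
  next
    case False
    have "h x \<noteq> 0" "h y \<noteq> 0" "h x \<noteq> h y"
      using False h0 h by (metis bij_is_inj injD)+
    then have "h x \<cdot> h y = 1 \<longleftrightarrow> x \<cdot> y = 1"
      using tri[of 0 x y] False by (simp add: triangledown_def h0)
    then show ?thesis by (metis bit_not_one_iff)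
  qed
  then show "(\<lambda>x. g x + g 0) \<in> Sp scale P"
    using dot_preserving_in_Sp[OF h] by (simp add: h_def[abs_def])
next
  assume s: "(\<lambda>x. g x + g 0) \<in> Sp scale P"
  define h where "h x = g x + g 0" for x
  have h: "bij h" "\<And>x y. h x \<cdot> h y = x \<cdot> y" using s unfolding Sp_iff h_def[abs_def] by blast+
  have "g = (\<lambda>x. x + g 0) \<circ> h" by (auto simp: h_def add.assoc)
  then have "bij g" using bij_comp[OF h(1) bij_translation] by metis
  have inj: "h x = h y \<longleftrightarrow> x = y" for x y using h(1) by (simp add: bij_is_inj inj_eq)
  have "triangledown P (g a) (g b) (g c) = triangledown P (h a) (h b) (h c)" for a b c
    by (simp add: h_def triangledown_translate)
  also have "\<dots> a b c = triangledown P a b c" for a b c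
    by (simp add: triangledown_def h(2) inj)
  finally show "g \<in> Delta P" using \<open>bij g\<close> by (simp add: Delta_def carrier_Sym)
qed

section \<open>Closed subgroups and automorphism groups of relations\<close>

lemma closed_overgroup_iff:
  "closed_overgroup scale P H \<longleftrightarrow> subgroup H Sym \<and> closed_in_Sym H \<and> Sp scale P \<subseteq> H"
proof
  assume "closed_overgroup scale P H"
  then interpret closed_overgroup scale P H .
  have "subgroup H Sym"
  proof (rule group.subgroupI[OF group_Sym])
    show "H \<subseteq> carrier Sym" using bij by (auto simp: carrier_Sym)
    show "H \<noteq> {}" using Sp_in[OF id_in_Sp] by blast
    show "inv\<^bsub>Sym\<^esub> g \<in> H" if "g \<in> H" for g using inv[OF that] bij[OF that] by (simp add: inv_Sym)
    show "g \<otimes>\<^bsub>Sym\<^esub> h \<in> H" if "g \<in> H" "h \<in> H" for g h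
      using comp[OF that] bij that by (simp add: mult_Sym)
  qed
  moreover have "closed_in_Sym H"
    unfolding closed_in_Sym_def using closed by (simp add: carrier_Sym)
  ultimately show "subgroup H Sym \<and> closed_in_Sym H \<and> Sp scale P \<subseteq> H" using Sp_subset by blast
next
  assume H: "subgroup H Sym \<and> closed_in_Sym H \<and> Sp scale P \<subseteq> H"
  then have H': "subgroup H Sym" by blast
  have bij: "bij g" if "g \<in> H" for g
    using subgroup.subset[OF H'] that by (auto simp: carrier_Sym)
  show "closed_overgroup scale P H"
  proof unfold_locales
    show "g \<circ> h \<in> H" if "g \<in> H" "h \<in> H" for g h
      using subgroup.m_closed[OF H' that] that bij by (simp add: mult_Sym)
    show "finv g \<in> H" if "g \<in> H" for g
      using subgroup.m_inv_closed[OF H' that] that bij by (simp add: inv_Sym)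
    show "\<pi> \<in> H" if "bij \<pi>" "\<And>S. finite S \<Longrightarrow> \<exists>\<sigma>\<in>H. \<forall>x\<in>S. \<sigma> x = \<pi> x" for \<pi>
      using H that by (auto simp: closed_in_Sym_def carrier_Sym)
  qed (use H bij in auto)
qed

text \<open>Arity 4 suffices for all six groups; unused arguments are ignored.\<close>
definition aut :: "('v \<Rightarrow> 'v \<Rightarrow> 'v \<Rightarrow> 'v \<Rightarrow> bool) \<Rightarrow> ('v \<Rightarrow> 'v) set" where
  "aut R = {g. bij g \<and> (\<forall>a b c d. R (g a) (g b) (g c) (g d) = R a b c d)}"

text \<open>Closedness holds since each instance of \<open>R\<close> involves only the finite set
  \<open>{a, b, c, d}\<close>.\<close>

lemma closed_overgroup_aut:
  assumes "Sp scale P \<subseteq> aut R"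
  shows "closed_overgroup scale P (aut R)"
proof unfold_locales
  show "g \<circ> h \<in> aut R" if "g \<in> aut R" "h \<in> aut R" for g h
    using that by (simp add: aut_def bij_comp)
  show "finv g \<in> aut R" if g: "g \<in> aut R" for g
  proof -
    have "R (finv g a) (finv g b) (finv g c) (finv g d) = R a b c d" for a b c d
    proof -
      have "R (g (finv g a)) (g (finv g b)) (g (finv g c)) (g (finv g d)) =
          R (finv g a) (finv g b) (finv g c) (finv g d)"
        using g by (simp only: aut_def mem_Collect_eq)
      then show ?thesis using g by (simp add: aut_def bij_is_surj surj_f_inv_f)
    qed
    then show ?thesis using g by (simp add: aut_def bij_imp_bij_inv)
  qed
  show "\<pi> \<in> aut R" if "bij \<pi>" and fin: "\<And>S. finite S \<Longrightarrow> \<exists>\<sigma>\<in>aut R. \<forall>x\<in>S. \<sigma> x = \<pi> x" for \<pi>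
  proof -
    have "R (\<pi> a) (\<pi> b) (\<pi> c) (\<pi> d) = R a b c d" for a b c d
    proof -
      obtain \<sigma> where \<sigma>: "\<sigma> \<in> aut R" "\<forall>x\<in>{a, b, c, d}. \<sigma> x = \<pi> x"
        using fin[of "{a, b, c, d}"] by auto
      then have "R (\<sigma> a) (\<sigma> b) (\<sigma> c) (\<sigma> d) = R a b c d" by (simp only: aut_def mem_Collect_eq)
      then show ?thesis using \<sigma>(2) by simp
    qed
    then show ?thesis using that(1) by (simp add: aut_def)
  qed
qed (use assms in \<open>auto simp: aut_def\<close>)

lemma carrier_Sym_eq_aut: "carrier Sym = aut (\<lambda>a b c d. True)"
  by (simp add: aut_def carrier_Sym)

lemma Sym0_eq_aut: "Sym0 = aut (\<lambda>a b c d. a = 0)"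
proof -
  have "g 0 = 0 \<longleftrightarrow> (\<forall>a. g a = 0 \<longleftrightarrow> a = 0)" if "bij g" for g :: "'v \<Rightarrow> 'v"
    using that by (metis bij_is_inj injD)
  then show ?thesis by (auto simp: Sym0_def aut_def carrier_Sym)
qed

lemma GL_eq_aut: "GL scale = aut (\<lambda>a b c d. c = a + b)"
proof -
  have "(\<forall>x y. g (x + y) = g x + g y) \<longleftrightarrow> (\<forall>a b c. g c = g a + g b \<longleftrightarrow> c = a + b)"
    if "bij g" for g :: "'v \<Rightarrow> 'v"
    using that by (metis bij_is_inj injD)
  then show ?thesis by (simp add: set_eq_iff GL_iff aut_def cong: conj_cong)
qed

lemma AGL_eq_aut: "AGL scale = aut (\<lambda>a b c d. d = a + b + c)"
proof -
  have "(\<forall>x y. g (x + y) = g x + g y + g 0) \<longleftrightarrow> (\<forall>a b c d. g d = g a + g b + g c \<longleftrightarrow> d = a + b + c)"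
    if "bij g" for g :: "'v \<Rightarrow> 'v"
  proof
    assume *: "\<forall>x y. g (x + y) = g x + g y + g 0"
    then have "g (a + b + c) = g a + g b + g c" for a b c
      unfolding *[rule_format, of "a + b" c] *[rule_format, of a b] by (simp add: ac_simps)
    then show "\<forall>a b c d. g d = g a + g b + g c \<longleftrightarrow> d = a + b + c"
      using that by (metis bij_is_inj injD)
  next
    assume "\<forall>a b c d. g d = g a + g b + g c \<longleftrightarrow> d = a + b + c"
    then show "\<forall>x y. g (x + y) = g x + g y + g 0" by (metis add_0_right)
  qed
  then show ?thesis by (simp add: set_eq_iff AGL_iff aut_def cong: conj_cong)
qed

lemma Sp_eq_aut: "Sp scale P = aut (\<lambda>a b c d. a \<cdot> b = 1)"
proof
  show "aut (\<lambda>a b c d. a \<cdot> b = 1) \<subseteq> Sp scale P"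
  proof
    fix g assume g: "g \<in> aut (\<lambda>a b c d. a \<cdot> b = 1)"
    show "g \<in> Sp scale P"
    proof (rule dot_preserving_in_Sp)
      show "g x \<cdot> g y = x \<cdot> y" for x y
      proof -
        have "g x \<cdot> g y = 1 \<longleftrightarrow> x \<cdot> y = 1" using g by (simp add: aut_def)
        then show ?thesis by (metis bit_not_one_iff)
      qed
    qed (use g in \<open>simp add: aut_def\<close>)
  qed
qed (auto simp: Sp_iff aut_def)

lemma Delta_eq_aut: "Delta P = aut (\<lambda>a b c d. triangledown P a b c)"
  by (auto simp: Delta_def aut_def carrier_Sym)

lemma closed_overgroups:
  assumes "H \<in> {Sp scale P, Delta P, GL scale, AGL scale, Sym0, carrier Sym}"
  shows "closed_overgroup scale P H"
proof -
  have GL: "Sp scale P \<subseteq> GL scale" by (auto simp: Sp_iff GL_iff)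
  have "Sp scale P \<subseteq> Delta P"
  proof
    fix g assume "g \<in> Sp scale P"
    moreover from this have "g 0 = 0" using GL GL_zero by blast
    ultimately show "g \<in> Delta P" by (simp add: Delta_iff)
  qed
  moreover have "Sp scale P \<subseteq> AGL scale" using GL GL_zero by (auto simp: AGL_iff GL_iff)
  moreover have "Sp scale P \<subseteq> Sym0" using GL GL_zero by (auto simp: Sym0_def GL_iff carrier_Sym)
  moreover have "Sp scale P \<subseteq> carrier Sym" by (auto simp: Sp_iff carrier_Sym)
  ultimately show ?thesis
    using assms GL closed_overgroup_aut
    unfolding carrier_Sym_eq_aut Sym0_eq_aut GL_eq_aut AGL_eq_aut Sp_eq_aut Delta_eq_aut
    by blast
qed

end

lemma (in zero_fixing_overgroup) zero_fixing_classification: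
  "G = Sp scale P \<or> G = GL scale \<or> G = Sym0"
proof (cases "\<exists>g\<in>G. \<exists>x y. g (x + y) \<noteq> g x + g y")
  case True
  then have "Sym0 \<subseteq> G" using Sym0_subset by blast
  moreover have "G \<subseteq> Sym0" using bij fixes_zero by (auto simp: Sym0_def carrier_Sym)
  ultimately show ?thesis by blast
next
  case False
  then have lin: "g (x + y) = g x + g y" if "g \<in> G" for g x y using that by blast
  then have "G \<subseteq> GL scale" using bij by (auto simp: GL_iff)
  moreover have "GL scale \<subseteq> G" if "G \<noteq> Sp scale P"
    by (rule GL_subset[OF _ that]) (rule lin)
  ultimately show ?thesis by blast
qed

subsection \<open>Closed overgroups moving 0\<close>

locale zero_moving_overgroup = closed_overgroup scale P G
  for scale :: "bit \<Rightarrow> 'v::ab_group_add \<Rightarrow> 'v" and P :: "bit \<Rightarrow> 'v \<Rightarrow> 'v \<Rightarrow> bool"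
    and G :: "('v \<Rightarrow> 'v) set" +
  assumes moves_zero: "\<exists>g\<in>G. g 0 \<noteq> 0"
begin

definition G0 :: "('v \<Rightarrow> 'v) set" where "G0 = {g \<in> G. g 0 = 0}"

sublocale stab: zero_fixing_overgroup scale P G0
proof
  show "g \<circ> h \<in> G0" if "g \<in> G0" "h \<in> G0" for g h
    using that comp by (simp add: G0_def)
  show "finv g \<in> G0" if "g \<in> G0" for g
    using that inv inv_left[of g 0] by (simp add: G0_def)
  show "Sp scale P \<subseteq> G0"
  proof
    fix s assume s: "s \<in> Sp scale P"
    then have "s \<in> GL scale" by (simp add: Sp_eq)
    then show "s \<in> G0" using Sp_in[OF s] GL_zero by (simp add: G0_def)
  qed
  show "\<pi> \<in> G0" if "bij \<pi>" "\<And>S. finite S \<Longrightarrow> \<exists>\<sigma>\<in>G0. \<forall>x\<in>S. \<sigma> x = \<pi> x" for \<pi>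
  proof -
    have "\<exists>\<sigma>\<in>G. \<forall>x\<in>S. \<sigma> x = \<pi> x" if "finite S" for S
      using \<open>finite S \<Longrightarrow> \<exists>\<sigma>\<in>G0. \<forall>x\<in>S. \<sigma> x = \<pi> x\<close> that by (auto simp: G0_def)
    then have "\<pi> \<in> G" by (rule closed[OF that(1)])
    moreover have "\<pi> 0 = 0" using that(2)[of "{0}"] by (auto simp: G0_def)
    ultimately show ?thesis by (simp add: G0_def)
  qed
qed (use bij in \<open>auto simp: G0_def\<close>)

text \<open>\<open>Sp\<close> is already transitive on nonzero vectors, so one element moving 0
  suffices.\<close>

lemma transitive: "\<exists>g\<in>G. g x = y"
proof -
  have from_zero: "\<exists>g\<in>G. g 0 = a" for a
  proof (cases "a = 0")
    case True
    then show ?thesis by (intro bexI[OF _ Sp_in[OF id_in_Sp]]) simp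
  next
    case False
    obtain g where g: "g \<in> G" "g 0 \<noteq> 0" using moves_zero by blast
    obtain s where "s \<in> Sp scale P" "s (g 0) = a"
      using Sp_transport[of "{}" "g 0" a] g(2) False by auto
    then show ?thesis using comp[OF Sp_in g(1), of s] by (intro bexI[of _ "s \<circ> g"]) auto
  qed
  obtain g h where gh: "g \<in> G" "g 0 = x" "h \<in> G" "h 0 = y" using from_zero by metis
  then have "finv g x = 0" using inv_left[OF gh(1), of 0] by simp
  then show ?thesis using gh comp[OF gh(3) inv[OF gh(1)]] by (intro bexI[of _ "h \<circ> finv g"]) auto
qed

lemma eq_Sym:
  assumes "G0 = Sym0"
  shows "G = carrier Sym"
proof
  show "G \<subseteq> carrier Sym" using bij by (auto simp: carrier_Sym)
  show "carrier Sym \<subseteq> G"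
  proof
    fix \<pi> :: "'v \<Rightarrow> 'v" assume "\<pi> \<in> carrier Sym"
    then have \<pi>: "bij \<pi>" by (simp add: carrier_Sym)
    obtain g where g: "g \<in> G" "g 0 = \<pi> 0" using transitive by blast
    have "finv g \<circ> \<pi> \<in> Sym0"
      using \<pi> bij[OF inv[OF g(1)]] inv_left[OF g(1), of 0] g(2)
      by (simp add: Sym0_def carrier_Sym bij_comp)
    then have "g \<circ> (finv g \<circ> \<pi>) \<in> G" using assms comp[OF g(1)] by (auto simp: G0_def)
    moreover have "g \<circ> (finv g \<circ> \<pi>) = \<pi>" using g(1) by auto
    ultimately show "\<pi> \<in> G" by simp
  qed
qed

section \<open>The affine structure from fixed points of stabilizers\<close>

text \<open>When the stabilizer of 0 is linear, \<open>a + b + c\<close> is the only further point fixed by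
  the stabilizer of \<open>a\<close>, \<open>b\<close>, \<open>c\<close>, so that the affine structure is invariant.\<close>

definition fourth :: "'v \<Rightarrow> 'v \<Rightarrow> 'v \<Rightarrow> 'v \<Rightarrow> bool" where
  "fourth a b c e \<longleftrightarrow> a \<noteq> b \<and> a \<noteq> c \<and> b \<noteq> c \<and> e \<notin> {a, b, c} \<and>
     (\<forall>g\<in>G. g a = a \<longrightarrow> g b = b \<longrightarrow> g c = c \<longrightarrow> g e = e)"

lemma fourth_perm: "fourth a b c e \<Longrightarrow> fourth b a c e" "fourth a b c e \<Longrightarrow> fourth c b a e"
  unfolding fourth_def by blast+

lemma fourth_image:
  assumes "fourth a b c e" "g \<in> G"
  shows "fourth (g a) (g b) (g c) (g e)"
proof -
  have "h (g e) = g e" if h: "h \<in> G" "h (g a) = g a" "h (g b) = g b" "h (g c) = g c" for h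
  proof -
    define k where "k = finv g \<circ> h \<circ> g"
    have "k \<in> G" unfolding k_def by (intro comp inv assms(2) h(1))
    moreover have "k a = a" "k b = b" "k c = c" using assms(2) h(2-4) by (simp_all add: k_def)
    ultimately have "(finv g \<circ> h \<circ> g) e = e"
      using assms(1) unfolding fourth_def k_def by blast
    then have "g (finv g (h (g e))) = g e" by simp
    then show ?thesis using assms(2) by simp
  qed
  then show ?thesis using assms by (auto simp: fourth_def)
qed

text \<open>A symplectic map fixing \<open>a\<close>, \<open>b\<close>, \<open>c\<close> moves any
  point outside their span.\<close>

lemma fourth_in_span:
  assumes "fourth a b c e"
  shows "e \<in> span {a, b, c}"
proof (rule ccontr)
  assume e: "e \<notin> span {a, b, c}"
  obtain y where y: "y \<notin> span (insert e ({a, b, c} \<union> {}))" "\<And>x. x \<in> span {a, b, c} \<Longrightarrow> y \<cdot> x = e \<cdot> x"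
    using exists_point_like[of "{}" "{a, b, c}" e] by blast
  have "y \<noteq> e" using y(1) span_base by blast
  have "y \<notin> span {a, b, c}" using y(1) span_mono[of "{a, b, c}" "insert e ({a, b, c} \<union> {})"] by blast
  then have "\<exists>s\<in>Sp scale P. (\<forall>x\<in>span {a, b, c}. s x = x) \<and> s e = y"
    using e y(2) by (intro Sp_transport) (auto simp: span_base)
  then obtain s where s: "s \<in> Sp scale P" "\<And>x. x \<in> span {a, b, c} \<Longrightarrow> s x = x" "s e = y" by blast
  then have "s a = a" "s b = b" "s c = c" by (simp_all add: span_base)
  then show False using assms Sp_in[OF s(1)] s(3) \<open>y \<noteq> e\<close> by (auto simp: fourth_def)
qed

end

locale affine_overgroup = zero_moving_overgroup +
  assumes linear_stabilizer: "G0 \<subseteq> GL scale"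
begin

lemma fourth_zero: "fourth 0 b c e \<longleftrightarrow> b \<noteq> 0 \<and> c \<noteq> 0 \<and> b \<noteq> c \<and> e = b + c"
proof
  assume f: "fourth 0 b c e"
  have "span {0, b, c} = {0, b, c, b + c}"
    by (auto simp: span_insert_bit)
  then show "b \<noteq> 0 \<and> c \<noteq> 0 \<and> b \<noteq> c \<and> e = b + c"
    using fourth_in_span[OF f] f by (auto simp: fourth_def)
next
  assume "b \<noteq> 0 \<and> c \<noteq> 0 \<and> b \<noteq> c \<and> e = b + c"
  moreover have "g (b + c) = b + c" if "g \<in> G" "g 0 = 0" "g b = b" "g c = c" for g
  proof -
    have "g \<in> GL scale" using that linear_stabilizer by (auto simp: G0_def)
    then show ?thesis using that by (simp add: GL_iff)
  qed
  ultimately show "fourth 0 b c e" by (auto simp: fourth_def add_eq_0_iff_eq)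
qed

text \<open>Moving \<open>a\<close> to 0 by transitivity reduces this to \<open>fourth_zero\<close>,
  where the relation is \<open>e = b + c\<close> and the symmetry is visible.\<close>

lemma fourth_exchange:
  assumes "fourth a b c e"
  shows "fourth a b e c"
proof -
  obtain g where g: "g \<in> G" "g a = 0" using transitive by blast
  have "fourth 0 (g b) (g c) (g e)" using fourth_image[OF assms g(1)] g(2) by simp
  then have "fourth 0 (g b) (g e) (g c)" by (auto simp: fourth_zero add_eq_0_iff_eq)
  then have "fourth (finv g 0) (finv g (g b)) (finv g (g e)) (finv g (g c))"
    by (rule fourth_image[OF _ inv[OF g(1)]])
  moreover have "finv g 0 = a" using inv_left[OF g(1), of a] g(2) by simp
  ultimately show ?thesis using g(1) by simp
qed

lemma fourth_unique:
  assumes "fourth a b c e" "fourth a b c e'"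
  shows "e = e'"
proof -
  obtain g where g: "g \<in> G" "g a = 0" using transitive by blast
  have "fourth 0 (g b) (g c) (g e)" "fourth 0 (g b) (g c) (g e')"
    using fourth_image[OF _ g(1)] assms g(2) by metis+
  then have "g e = g e'" by (simp add: fourth_zero)
  then show ?thesis using g(1) by simp
qed

text \<open>If \<open>e = a + b\<close>, then both 0 and \<open>c\<close> are fourth points for
  \<open>a\<close>, \<open>b\<close>, \<open>a + b\<close>, so uniqueness would give
  \<open>c = 0\<close>.\<close>

lemma fourth_not_sum_of_two:
  assumes "fourth a b c e" "a \<noteq> 0" "b \<noteq> 0" "c \<noteq> 0"
  shows "e \<noteq> a + b"
proof
  assume e: "e = a + b"
  have "a \<noteq> b" using assms(1) by (simp add: fourth_def)
  then have "fourth 0 b a (a + b)" using assms(2,3) by (simp add: fourth_zero add.commute)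
  then have "fourth a b 0 (a + b)" by (rule fourth_perm(2))
  then have "fourth a b (a + b) 0" by (rule fourth_exchange)
  moreover have "fourth a b (a + b) c" using fourth_exchange[OF assms(1)] e by simp
  ultimately show False using fourth_unique assms(4) by blast
qed

text \<open>When one of the points is 0, \<open>fourth_zero\<close> applies after a permutation.
  Otherwise \<open>e\<close> is one of eight sums in the span, and all but \<open>a + b + c\<close>
  are excluded.\<close>

lemma fourth_eq_sum:
  assumes f: "fourth a b c e"
  shows "e = a + b + c"
proof -
  note perm = fourth_perm(1)[OF f] fourth_perm(2)[OF f] fourth_perm(2)[OF fourth_perm(1)[OF f]]
  show ?thesis
  proof (cases "a = 0 \<or> b = 0 \<or> c = 0 \<or> e = 0")
    case True
    have "fourth a b e c" using fourth_exchange[OF f] .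
    then have "fourth e b a c" by (rule fourth_perm(2))
    then show ?thesis using True f perm by (auto simp: fourth_zero ac_simps)
  next
    case False
    have "span {a, b, c} = {0, a, b, c, a + b, a + c, b + c, a + b + c}"
      by (auto simp: span_insert_bit ac_simps)
    moreover have "e \<noteq> a + b" "e \<noteq> a + c" "e \<noteq> b + c"
      using fourth_not_sum_of_two[OF f] fourth_not_sum_of_two[OF perm(2)]
        fourth_not_sum_of_two[OF perm(3)] fourth_not_sum_of_two[OF fourth_perm(1)[OF perm(3)]]
        False by (auto simp: ac_simps)
    ultimately show ?thesis using fourth_in_span[OF f] f False by (auto simp: fourth_def)
  qed
qed

lemma affine:
  assumes g: "g \<in> G"
  shows "g (x + y) = g x + g y + g 0"
proof (cases "x = 0 \<or> y = 0 \<or> x = y")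
  case True
  then show ?thesis by (auto simp: ac_simps)
next
  case False
  then have "fourth 0 x y (x + y)" by (simp add: fourth_zero)
  from fourth_eq_sum[OF fourth_image[OF this g]] show ?thesis by (simp add: ac_simps)
qed

section \<open>Identification of the group with \<open>AGL\<close> or \<open>Delta\<close>\<close>

lemma eq_AGL:
  assumes "G0 = GL scale"
  shows "G = AGL scale"
proof
  show "G \<subseteq> AGL scale" using affine bij by (auto simp: AGL_iff)
  show "AGL scale \<subseteq> G"
  proof
    fix g assume "g \<in> AGL scale"
    then have g: "bij g" "\<And>x y. g (x + y) = g x + g y + g 0" by (auto simp: AGL_iff)
    obtain k where k: "k \<in> G" "k 0 = g 0" using transitive by blast
    have "finv k (g 0) = 0" using inv_left[OF k(1), of 0] k(2) by simp
    moreover have "finv k (x + y + g 0) = finv k x + finv k y" if "finv k (g 0) = 0" for x y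
      using affine[OF inv[OF k(1)], of "x + y" "g 0"] affine[OF inv[OF k(1)], of x y] that
      by (simp add: add.assoc)
    ultimately have "finv k \<circ> g \<in> GL scale"
      using bij_comp[OF g(1) bij[OF inv[OF k(1)]]] by (simp add: GL_iff g(2))
    then have "k \<circ> (finv k \<circ> g) \<in> G" using assms comp[OF k(1)] by (auto simp: G0_def)
    moreover have "k \<circ> (finv k \<circ> g) = g" using k(1) by auto
    ultimately show "g \<in> G" by simp
  qed
qed

text \<open>The linear part \<open>h\<close> of \<open>g\<close> is shown to preserve the form. If
  \<open>h y\<close> is orthogonal to \<open>g 0\<close>, the transvection along \<open>h y\<close>
  fixes \<open>g 0\<close>; its conjugate by \<open>g\<close> fixes 0, so it is symplectic, and this
  gives the products with \<open>y\<close>.\<close>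

lemma subset_Delta:
  assumes G0: "G0 = Sp scale P"
  shows "G \<subseteq> Delta P"
proof
  fix g assume g: "g \<in> G"
  define h where "h x = g x + g 0" for x
  have h_add: "h (x + y) = h x + h y" for x y by (simp add: h_def affine[OF g, of x y] ac_simps)
  have h: "bij h"
    using bij_comp[OF bij[OF g] bij_translation[of "g 0"]] by (simp add: h_def[abs_def] comp_def)
  have h0: "h 0 = 0" by (simp add: h_def)
  have g_eq: "g x = h x + g 0" for x by (simp add: h_def add.assoc)
  have orth: "h x \<cdot> h y = x \<cdot> y" if y: "h y \<cdot> g 0 = 0" for x y
  proof -
    define t where "t x = x + scale (x \<cdot> h y) (h y)" for x
    have t: "t \<in> Sp scale P" using transvection_in_Sp[of "h y"] by (simp add: t_def[abs_def])
    text \<open>The conjugate of the transvection \<open>t\<close> by \<open>g\<close>, which fixes 0.\<close>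
    define k where "k x = x + scale (h x \<cdot> h y) y" for x
    have "g (k x) = t (g x)" for x
      unfolding g_eq[of "k x"] g_eq[of x] using y
      by (simp add: k_def t_def scale_bit h_add h0 dot_add_left dot_commute[of "g 0"] ac_simps)
    then have "k x = (finv g \<circ> t \<circ> g) x" for x using inv_left[OF g, of "k x"] by simp
    then have "k = finv g \<circ> t \<circ> g" by blast
    then have "k \<in> G" using g Sp_in[OF t] by (auto intro!: comp inv)
    moreover have "k 0 = 0" by (simp add: k_def h0)
    ultimately have k: "k \<in> Sp scale P" using G0 by (auto simp: G0_def)
    \<comment> \<open>Expanding \<open>k x \<cdot> k z = x \<cdot> z\<close> leaves \<open>(h x
      \<cdot> h y) * (y \<cdot> z) = (h z \<cdot> h y) * (x \<cdot> y)\<close>.\<close>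
    have swap: "h x \<cdot> h y = 1 \<and> y \<cdot> z = 1 \<longleftrightarrow> h z \<cdot> h y = 1 \<and> x \<cdot> y = 1" for x z
    proof -
      have "k x \<cdot> k z = x \<cdot> z" using k by (simp add: Sp_iff)
      then show ?thesis
        by (auto simp: k_def scale_bit dot_add_left dot_add_right split: if_splits)
    qed
    show ?thesis
    proof (cases "y = 0")
      case True
      then show ?thesis by (simp add: h0)
    next
      case False
      have "h y \<noteq> 0" using False h h0 by (metis bij_is_inj injD)
      obtain u where "y \<cdot> u \<noteq> 0" using nondegenerate[of y] False by blast
      then have u: "y \<cdot> u = 1" "u \<cdot> y = 1" using dot_commute[of u y] by simp_all
      obtain v' where "h y \<cdot> v' \<noteq> 0" using nondegenerate[of "h y"] \<open>h y \<noteq> 0\<close> by blast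
      moreover obtain v where "v' = h v" using h by (metis bij_pointE)
      ultimately have v: "h v \<cdot> h y = 1" using dot_commute[of "h y"] by simp
      have "h u \<cdot> h y = 1" using swap[of v u] v u by simp
      then have "h x \<cdot> h y = 1 \<longleftrightarrow> x \<cdot> y = 1" using swap[of x u] u by simp
      then show ?thesis by (metis bit_not_one_iff)
    qed
  qed
  have "h x \<cdot> h y = x \<cdot> y" for x y
  proof (cases "h y \<cdot> g 0 = 0 \<or> h x \<cdot> g 0 = 0")
    case True
    then show ?thesis using orth dot_commute by metis
  next
    case False
    \<comment> \<open>Among \<open>x\<close>, \<open>y\<close>, \<open>x + y\<close> at least one
      has its image orthogonal to \<open>g 0\<close>; in this last case \<open>orth\<close> is
      applied to \<open>x\<close> and \<open>x + y\<close>.\<close>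
    then have "h (x + y) \<cdot> g 0 = 0" by (simp add: h_add dot_add_left)
    from orth[OF this, of x] show ?thesis by (simp add: h_add dot_add_right)
  qed
  then have "h \<in> Sp scale P" by (rule dot_preserving_in_Sp[OF h])
  then show "g \<in> Delta P" by (simp add: Delta_iff h_def[abs_def])
qed

lemma eq_Delta:
  assumes "G0 = Sp scale P"
  shows "G = Delta P"
proof
  show "G \<subseteq> Delta P" using assms by (rule subset_Delta)
  show "Delta P \<subseteq> G"
  proof
    fix g assume "g \<in> Delta P"
    then have h: "(\<lambda>x. g x + g 0) \<in> Sp scale P" by (simp add: Delta_iff)
    obtain k where k: "k \<in> G" "k 0 = g 0" using transitive by blast
    then have k': "(\<lambda>x. k x + k 0) \<in> Sp scale P" using subset_Delta[OF assms] by (auto simp: Delta_iff)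
    \<comment> \<open>As \<open>k 0 = g 0\<close>, both \<open>k\<close> and \<open>g\<close> are
      symplectic maps followed by the same translation, so they differ by elements of
      \<open>Sp\<close>.\<close>
    have "k \<circ> finv (\<lambda>x. k x + k 0) \<circ> (\<lambda>x. g x + g 0) \<in> G"
      by (intro comp inv k(1) Sp_in k' h)
    moreover have "k (finv (\<lambda>x. k x + k 0) (g x + g 0)) = g x" for x
    proof -
      have "k (finv (\<lambda>x. k x + k 0) (g x + g 0)) + k 0 = g x + g 0"
        using inv_right[OF Sp_in[OF k']] .
      then show ?thesis using k(2) by simp
    qed
    then have "k \<circ> finv (\<lambda>x. k x + k 0) \<circ> (\<lambda>x. g x + g 0) = g" by auto
    ultimately show "g \<in> G" by simp
  qed
qed

end

lemma (in closed_overgroup) classification: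
  "G \<in> {Sp scale P, Delta P, GL scale, AGL scale, Sym0, carrier Sym}"
proof (cases "\<exists>g\<in>G. g 0 \<noteq> 0")
  case True
  then interpret zero_moving_overgroup scale P G by unfold_locales
  show ?thesis
  proof (cases "G0 = Sym0")
    case False
    then have cases: "G0 = Sp scale P \<or> G0 = GL scale" using stab.zero_fixing_classification by blast
    have "G0 \<subseteq> GL scale" using cases by (auto simp: Sp_iff GL_iff)
    then interpret affine_overgroup scale P G by unfold_locales
    show ?thesis using cases eq_AGL eq_Delta by blast
  qed (use eq_Sym in blast)
next
  case False
  then interpret zero_fixing_overgroup scale P G by unfold_locales blast
  show ?thesis using zero_fixing_classification by blast
qed

theorem theorem4p19:
  fixes scale :: "bit \<Rightarrow> 'v::ab_group_add \<Rightarrow> 'v"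
    and P :: "bit \<Rightarrow> 'v \<Rightarrow> 'v \<Rightarrow> bool"
  assumes "fraisse_limit scale P"
  shows "{H. subgroup H Sym \<and> closed_in_Sym H \<and> Sp scale P \<subseteq> H} =
         {Sp scale P, Delta P, GL scale, AGL scale, Sym0, carrier Sym}"
proof -
  interpret fraisse_limit scale P by fact
  show ?thesis
  proof (intro equalityI subsetI)
    fix H assume "H \<in> {H. subgroup H Sym \<and> closed_in_Sym H \<and> Sp scale P \<subseteq> H}"
    then have "closed_overgroup scale P H" by (simp only: closed_overgroup_iff mem_Collect_eq)
    then show "H \<in> {Sp scale P, Delta P, GL scale, AGL scale, Sym0, carrier Sym}"
      by (rule closed_overgroup.classification)
  next
    fix H assume "H \<in> {Sp scale P, Delta P, GL scale, AGL scale, Sym0, carrier Sym}"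
    then have "closed_overgroup scale P H" by (rule closed_overgroups)
    then show "H \<in> {H. subgroup H Sym \<and> closed_in_Sym H \<and> Sp scale P \<subseteq> H}"
      by (simp only: closed_overgroup_iff mem_Collect_eq)
  qed
qed

end
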